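(* For every $n\ge 2$ and all $t\in\mathbb{F}_2^{n+1}$, $t'\in\mathbb{F}_2^{n}$, $t''\in\mathbb{F}_2^{n-1}$, the lengths of the rings $\widehat{R(n,t)}$ satisfy $$\ell(\widehat{R(n,t)})=\ell(\widehat{R(n-1,t')})+\ell(\widehat{R(n-2,t'')}).$$ Consequently, if $F$ is the Fibonacci sequence with $F(0)=0$ and $F(1)=1$, then for every $n\ge 0$ and $t\in\mathbb{F}_2^{n+1}$, $$\ell(\widehat{R(n,t)})=F(n+3)=\frac{(1+\sqrt5)^{n+3}-(1-\sqrt5)^{n+3}}{2^{n+3}\sqrt5}.$$
   Context: Throughout, $k$ is a field and $\ell$ denotes length (of a ring as a module over itself). Ladder-like structures. For $n\ge 0$ and $t=(t_1,\dots,t_{n+1})\in\mathbb{F}_2^{n+1}$, $L_n^t$ is a partially filled array with $\lfloor n/2\rfloor+2$ rows (numbered top to bottom) and $\lceil n/2\rceil+2$ columns (numbered left to right); its nonzero entries are the variables $x_0,x_2,x_3,\dots,x_{2n+4}$ (there is no $x_1$), each occurring exactly once, all other positions being empty. It is defined recursively, with $\widehat t=(t_1,\dots,t_n)$: - $L_0^t$ has first row $x_0,x_2$ and second row $x_3,x_4$ (for both values of $t$). - $L_1^t$ has first row $x_0,x_2,x_5$ and second row $x_3,x_4,x_6$ (for all $t$). - For $n\ge 2$ even, $L_n^t$ is $L_{n-1}^{\widehat t}$ with a new bottom row added whose only nonzero entries are $x_{2n+4}$, in the last column, and $x_{2n+3}$, in the column containing the first (if $t_{n+1}=0$) or the second (if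 $t_{n+1}=1$) nonzero entry, from left to right, of the row immediately above the new row. - For $n\ge 3$ odd, $L_n^t$ is $L_{n-1}^{\widehat t}$ with a new rightmost column added whose only nonzero entries are $x_{2n+4}$, in the last row, and $x_{2n+3}$, in the row containing the first (if $t_{n+1}=0$) or the second (if $t_{n+1}=1$) nonzero entry, from top to bottom, of the column immediately to the left of the new column. Graphs and toric rings. $G_n^t$ is the bipartite graph with one vertex for each row and one vertex for each column of $L_n^t$, and, for each nonzero entry $x_j$ of $L_n^t$, one edge (called $x_j$) joining the vertex of its row to the vertex of its column. Let $V$ be its vertex set, $S(n)=k[x_0,x_2,x_3,\dots,x_{2n+4}]$ the polynomial ring on the edges, and $I_{G_n^t}$ (the toric ideal) the kernel of the $k$-algebra homomorphism $S(n)\to k[V]$ sending each edge to the product of its two endpoints. The toric ring is $R(n,t)=S(n)/I_{G_n^t}$, graded with all variables in degree 1. Let $X_n=x_0,\,x_2-x_3,\,x_4-x_5,\ldots,x_{2n+2}-x_{2n+3},\,x_{2n+4}$ and let $\overline{X_n}$ be its image in $R(n,t)$. The ring $\widehat{R(n,t)}$ is $R(n,t)/(\overline{X_n})$, identified with $k[x_3,x_5,\dots,x_{2n+3}]/\widehat{I_{G_n^t}}$, where $\widehat{I_{G_n^t}}$ is the image of $I_{G_n^t}$ under the substitution $x_0,x_{2n+4}\mapsto 0$, $x_{2i}\mapsto x_{2i+1}$ for $1\le i\le n+1$ (odd-indexed variables fixed). (It is not a completion.) *)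

theory Defs
  imports
    "HOL-Algebra.QuotRing"
    "HOL-Algebra.Module"
    "HOL-Library.Poly_Mapping"
    "HOL-Library.Extended_Nat"
    "HOL-Library.Infinite_Set"
    "HOL-Library.Z2"
    "HOL-Number_Theory.Fib"
begin

section \<open>Length\<close>

text \<open>The length of a module is the supremum of the lengths of the strictly increasing chains of
  submodules; it is infinite if these lengths are unbounded.\<close>

definition module_length :: "('a, 'r) ring_scheme \<Rightarrow> ('a, 'b, 'm) module_scheme \<Rightarrow> enat" where
  "module_length A M =
    (SUP n \<in> {n. \<exists>N. (\<forall>i\<le>n. submodule (N i) A M) \<and> (\<forall>i<n. N i \<subset> N (Suc i))}. enat n)"

definition self_module :: "('a, 'r) ring_scheme \<Rightarrow> ('a, 'a) module" where
  "self_module A = \<lparr>carrier = carrier A, mult = mult A, one = one A, zero = zero A,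
    add = add A, smult = mult A\<rparr>"

definition ring_length :: "('a, 'r) ring_scheme \<Rightarrow> enat" where
  "ring_length A = module_length A (self_module A)"


section \<open>Polynomial rings\<close>

text \<open>A monomial is a finitely supported exponent vector, a polynomial a finitely supported
  function from monomials to coefficients. The type has all elements of \<open>'x\<close> as variables;
  \<open>mpoly_ring X\<close> is the polynomial ring on the variables in \<open>X\<close>.\<close>

type_synonym ('x, 'k) mpoly = "('x \<Rightarrow>\<^sub>0 nat) \<Rightarrow>\<^sub>0 'k"

definition mvar :: "'x \<Rightarrow> ('x, 'k::field) mpoly" where
  "mvar x = Poly_Mapping.single (Poly_Mapping.single x 1) 1"

definition mconst :: "'k::field \<Rightarrow> ('x, 'k) mpoly" where
  "mconst a = Poly_Mapping.single 0 a"

definition mpoly_ring :: "'x set \<Rightarrow> ('x, 'k::field) mpoly ring" where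
  "mpoly_ring X = \<lparr>carrier = {p. \<forall>m \<in> Poly_Mapping.keys p. Poly_Mapping.keys m \<subseteq> X},
    mult = (*), one = 1, zero = 0, add = (+)\<rparr>"

text \<open>The \<open>k\<close>-algebra homomorphism sending each variable \<open>x\<close> to \<open>f x\<close>.\<close>

definition mpoly_subst :: "('x \<Rightarrow> ('y, 'k) mpoly) \<Rightarrow> ('x, 'k::field) mpoly \<Rightarrow> ('y, 'k) mpoly" where
  "mpoly_subst f p = (\<Sum>m \<in> Poly_Mapping.keys p. mconst (Poly_Mapping.lookup p m) *
    (\<Prod>x \<in> Poly_Mapping.keys m. f x ^ Poly_Mapping.lookup m x))"


section \<open>Toric ideals of graphs\<close>

text \<open>Undirected graphs with named edges; \<open>ends G e\<close> is the set of endpoints of \<open>e\<close>.\<close>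

record ('v, 'e) edge_graph =
  verts :: "'v set"
  edges :: "'e set"
  ends :: "'e \<Rightarrow> 'v set"

definition toric_hom :: "('v, 'e) edge_graph \<Rightarrow> ('e, 'k::field) mpoly \<Rightarrow> ('v, 'k) mpoly" where
  "toric_hom G = mpoly_subst (\<lambda>e. \<Prod>v \<in> ends G e. mvar v)"

definition toric_ideal :: "('v, 'e) edge_graph \<Rightarrow> ('e, 'k::field) mpoly set" where
  "toric_ideal G = a_kernel (mpoly_ring (edges G)) (mpoly_ring (verts G)) (toric_hom G)"


section \<open>Ladder-like structures\<close>

text \<open>An array is a partial function from positions (row, column), both counted from 1; the entry
  \<open>Some j\<close> stands for the variable \<open>x\<^sub>j\<close>, and empty positions are undefined.

  A vector \<open>(t\<^sub>1, \<dots>, t\<^sub>n\<^sub>+\<^sub>1)\<close> over the field with two elements is a list of length \<open>n + 1\<close>, so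
  that dropping its final coordinate is \<^const>\<open>butlast\<close>. In \<open>enumerate S i\<close> the elements of \<open>S\<close>
  are counted from 0 in increasing order.\<close>

definition nrows :: "nat \<Rightarrow> nat" where
  "nrows n = n div 2 + 2"

definition ncols :: "nat \<Rightarrow> nat" where
  "ncols n = (n + 1) div 2 + 2"

fun ladder_array :: "nat \<Rightarrow> bit list \<Rightarrow> (nat \<times> nat \<rightharpoonup> nat)" where
  "ladder_array 0 t = [(1,1) \<mapsto> 0, (1,2) \<mapsto> 2,
                 (2,1) \<mapsto> 3, (2,2) \<mapsto> 4]"
| "ladder_array (Suc 0) t = [(1,1) \<mapsto> 0, (1,2) \<mapsto> 2, (1,3) \<mapsto> 5,
                       (2,1) \<mapsto> 3, (2,2) \<mapsto> 4, (2,3) \<mapsto> 6]"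
| "ladder_array (Suc (Suc m)) t =
    (let n = Suc (Suc m);
         A = ladder_array (Suc m) (butlast t);
         i = (if last t = 0 then 0 else 1);
         r = nrows n;
         c = ncols n
     in if even n
        then A((r, enumerate {c'. (r - 1, c') \<in> dom A} i) \<mapsto> 2 * n + 3, (r, c) \<mapsto> 2 * n + 4)
        else A((enumerate {r'. (r', c - 1) \<in> dom A} i, c) \<mapsto> 2 * n + 3, (r, c) \<mapsto> 2 * n + 4))"

datatype vertex = Row nat | Col nat

definition ladder_graph :: "nat \<Rightarrow> bit list \<Rightarrow> (vertex, nat) edge_graph" where
  "ladder_graph n t = \<lparr>
    verts = Row ` {1..nrows n} \<union> Col ` {1..ncols n},
    edges = ran (ladder_array n t),
    ends = (\<lambda>j. \<Union>{{Row r, Col c} | r c. ladder_array n t (r, c) = Some j})\<rparr>"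


section \<open>The toric rings and their Artinian reductions\<close>

text \<open>The argument \<open>TYPE('k)\<close> names the base field.\<close>

definition poly_S :: "'k::field itself \<Rightarrow> nat \<Rightarrow> (nat, 'k) mpoly ring" where
  "poly_S k n = mpoly_ring ({0} \<union> {2..2 * n + 4})"

definition toric_R :: "'k::field itself \<Rightarrow> nat \<Rightarrow> bit list \<Rightarrow> (nat, 'k) mpoly set ring" where
  "toric_R k n t = poly_S k n Quot toric_ideal (ladder_graph n t)"

definition params_X :: "'k::field itself \<Rightarrow> nat \<Rightarrow> (nat, 'k) mpoly set" where
  "params_X k n = {mvar 0, mvar (2 * n + 4)} \<union> {mvar (2 * i) - mvar (2 * i + 1) | i. i \<in> {1..n + 1}}"

definition params_Xbar :: "'k::field itself \<Rightarrow> nat \<Rightarrow> bit list \<Rightarrow> (nat, 'k) mpoly set set" where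
  "params_Xbar k n t = (\<lambda>f. toric_ideal (ladder_graph n t) +>\<^bsub>poly_S k n\<^esub> f) ` params_X k n"

definition toric_Rhat :: "'k::field itself \<Rightarrow> nat \<Rightarrow> bit list \<Rightarrow> (nat, 'k) mpoly set set ring" where
  "toric_Rhat k n t = toric_R k n t Quot Idl\<^bsub>toric_R k n t\<^esub> (params_Xbar k n t)"

end

theory Submission
  imports Defs "HOL-Real_Asymp.Real_Asymp"
begin

text \<open>Let \<open>I\<close> be the toric ideal, \<open>X\<close> the \<open>n + 3\<close> linear forms that cut out the Artinian
  reduction, and \<open>J\<close> the ideal generated by \<open>I\<close> and \<open>X\<close>. Modulo \<open>X\<close> the variables
  \<open>x(2i)\<close> and \<open>x(2i + 1)\<close> become one variable \<open>y(i)\<close>, for \<open>i\<close> in \<open>{1..n + 1}\<close>, while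
  \<open>x(0)\<close> and \<open>x(2n + 4)\<close> vanish.

  Upper bound. The initial two-by-two array is a 4-cycle of the graph, and each row or column that
  is added closes two more. They give binomials in \<open>I\<close> with leading terms \<open>x(2i) x(2i + 1)\<close> and \<open>x(2i + 1) x(2i + 3)\<close>,
  whose other terms are divisible by \<open>x(2i + 2)\<close> and \<open>x(2i + 4)\<close>. Used as rewrite rules for
  \<open>y(i)\<^sup>2\<close> and \<open>y(i) y(i + 1)\<close> they push exponents towards later variables, so rewriting stops.
  What remains are the products of the \<open>y(i)\<close> over sets of indices without consecutive elements
  (\<open>mon_mem_span_normal_forms\<close>). There are \<open>F(n + 3)\<close> such sets (\<open>card_sparse_sets\<close>), and a
  chain of ideals above \<open>J\<close> is a chain of subspaces of the span of these products modulo \<open>J\<close>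
  (\<open>ideal_chain_length_le\<close>).

  Lower bound. That the normal forms are independent modulo \<open>J\<close> is shown by counting
  (\<open>card_spanning_ge\<close>). If the monomials in \<open>B\<close> span modulo \<open>J\<close>, then by graded Nakayama the
  toric ring is generated by \<open>B\<close> as a module over the subalgebra generated by \<open>X\<close>
  (\<open>graded_Nakayama\<close>), so its part of degree at most \<open>d\<close> has dimension at most \<open>|B| N(d)\<close>, where
  \<open>N(d)\<close> is the number of monomials of degree at most \<open>d\<close> in \<open>n + 3\<close> variables. On the other hand
  monomials that avoid all the leading terms have pairwise different vertex degrees
  (\<open>standard_eqI\<close>) and so are independent in the toric ring. For each of the \<open>F(n + 3)\<close> sets \<open>T\<close>
  without consecutive elements, the \<open>n + 3\<close> variables \<open>x(0)\<close>, \<open>x(2n + 4)\<close>, \<open>x(2i + 1)\<close> for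
  \<open>i\<close> in \<open>T\<close> and \<open>x(2i)\<close> for the other \<open>i\<close> have only such monomials, and those in which all
  \<open>n + 3\<close> variables occur determine \<open>T\<close>. Hence \<open>F(n + 3) N(d) \<le> |B| N(d + n + 3)\<close> for all \<open>d\<close>,
  and since \<open>N\<close> grows polynomially, \<open>F(n + 3) \<le> |B|\<close> (\<open>growth_comparison\<close>). Adding the normal
  forms to \<open>J\<close> one at a time, by decreasing degree, then gives a strict chain of ideals
  (\<open>ideal_chain_exists\<close>).

  The vector \<open>t\<close> enters only through three features of the graph, the assumptions of the locale
  \<open>ladder_toric\<close>. They hold for every \<open>t\<close> by induction along the construction of the array
  (\<open>ladder_toric_ladder_graph\<close>).\<close>

section \<open>Polynomials as linear combinations of monomials\<close>

abbreviation keys :: "('a \<Rightarrow>\<^sub>0 'b::zero) \<Rightarrow> 'a set" where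
  "keys \<equiv> Poly_Mapping.keys"

abbreviation lookup :: "('a \<Rightarrow>\<^sub>0 'b::zero) \<Rightarrow> 'a \<Rightarrow> 'b" where
  "lookup \<equiv> Poly_Mapping.lookup"

abbreviation single :: "'a \<Rightarrow> 'b::zero \<Rightarrow> 'a \<Rightarrow>\<^sub>0 'b" where
  "single \<equiv> Poly_Mapping.single"

abbreviation mon :: "('x \<Rightarrow>\<^sub>0 nat) \<Rightarrow> ('x, 'k::field) mpoly" where
  "mon m \<equiv> single m 1"

interpretation mpoly: vector_space "\<lambda>(a::'k::field) (p::('x, 'k) mpoly). mconst a * p"
proof
  fix a b :: 'k and p q :: "('x, 'k) mpoly"
  show "mconst a * (p + q) = mconst a * p + mconst a * q"
    by (rule distrib_left)
  show "mconst (a + b) * p = mconst a * p + mconst b * p"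
    by (simp add: mconst_def single_add distrib_right)
  show "mconst a * (mconst b * p) = mconst (a * b) * p"
    by (simp add: mconst_def mult_single mult.assoc [symmetric])
  show "mconst 1 * p = p"
    by (simp add: mconst_def)
qed

lemma lookup_mconst_mult [simp]:
  "lookup (mconst a * p) m = a * lookup p m"
  by (simp add: mconst_def mult_map_scale_conv_mult [symmetric] Poly_Mapping.map.rep_eq when_def)

lemma mconst_mult_single [simp]:
  "mconst a * single m b = single m (a * b)"
  by (simp add: mconst_def mult_single)

lemma mpoly_eq_sum_mon:
  "(p :: ('x, 'k::field) mpoly)
    = (\<Sum>m \<in> keys p. mconst (lookup p m) * mon m)"
  by (rule poly_mapping_eqI)
    (auto simp: lookup_sum lookup_single when_def sum.delta' if_distrib in_keys_iff cong: if_cong)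

lemma mem_mpoly_ring_iff:
  "p \<in> carrier (mpoly_ring X) \<longleftrightarrow> (\<forall>m \<in> keys p. keys m \<subseteq> X)"
  by (simp add: mpoly_ring_def)

lemma mpoly_ring_simps [simp]:
  "mult (mpoly_ring X) = (*)" "add (mpoly_ring X) = (+)"
  "one (mpoly_ring X) = 1" "zero (mpoly_ring X) = 0"
  by (simp_all add: mpoly_ring_def)

lemma keys_subset_add:
  fixes m m' :: "'x \<Rightarrow>\<^sub>0 nat"
  assumes "keys m \<subseteq> X" "keys m' \<subseteq> X"
  shows "keys (m + m') \<subseteq> X"
  using assms Poly_Mapping.keys_add[of m m'] by blast

lemma keys_mconst_mult: "keys (mconst c * p) \<subseteq> keys p"
  by (auto simp: in_keys_iff)

lemma subspace_mpoly_ring: "mpoly.subspace (carrier (mpoly_ring X :: ('x, 'k::field) mpoly ring))"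
proof (rule mpoly.subspaceI)
  fix p q :: "('x, 'k) mpoly" assume "p \<in> carrier (mpoly_ring X)" "q \<in> carrier (mpoly_ring X)"
  then show "p + q \<in> carrier (mpoly_ring X)"
    using Poly_Mapping.keys_add [of p q] unfolding mem_mpoly_ring_iff by blast
next
  fix c and p :: "('x, 'k) mpoly" assume "p \<in> carrier (mpoly_ring X)"
  then show "mconst c * p \<in> carrier (mpoly_ring X)"
    using keys_mconst_mult [of c p] unfolding mem_mpoly_ring_iff by blast
qed (simp add: mem_mpoly_ring_iff)

lemma carrier_mpoly_ring:
  "carrier (mpoly_ring X :: ('x, 'k::field) mpoly ring)
    = mpoly.span (mon ` {m. keys m \<subseteq> X})"
proof
  show "carrier (mpoly_ring X :: ('x, 'k) mpoly ring)
      \<subseteq> mpoly.span (mon ` {m. keys m \<subseteq> X})"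
  proof
    fix p :: "('x, 'k) mpoly" assume "p \<in> carrier (mpoly_ring X)"
    then show "p \<in> mpoly.span (mon ` {m. keys m \<subseteq> X})"
      by (subst mpoly_eq_sum_mon)
        (intro mpoly.span_sum mpoly.span_scale mpoly.span_base, auto simp: mem_mpoly_ring_iff)
  qed
qed (rule mpoly.span_minimal, auto simp: mem_mpoly_ring_iff subspace_mpoly_ring)

lemma mem_span_mon: "p \<in> mpoly.span (range mon)"
proof -
  have "p \<in> carrier (mpoly_ring UNIV)" by (simp add: mem_mpoly_ring_iff)
  then show ?thesis by (simp add: carrier_mpoly_ring)
qed

lemma independent_mon: "mpoly.independent (mon ` A :: ('x, 'k::field) mpoly set)"
  unfolding mpoly.dependent_def
proof safe
  fix m assume m: "mon m \<in> mpoly.span (mon ` A - {mon m :: ('x, 'k) mpoly})"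
  have "mpoly.subspace {p :: ('x, 'k) mpoly. lookup p m = 0}"
    by (auto simp: mpoly.subspace_def lookup_add)
  then have "mon m \<in> {p :: ('x, 'k) mpoly. lookup p m = 0}"
    by (rule mpoly.span_subspace_induct [OF m]) (auto simp: lookup_single when_def)
  then show False by simp
qed

lemma inj_mon: "inj_on (mon :: _ \<Rightarrow> ('x, 'k::field) mpoly) A"
proof
  fix m m' :: "'x \<Rightarrow>\<^sub>0 nat"
  assume "(mon m :: ('x, 'k) mpoly) = mon m'"
  then have "keys (mon m :: ('x, 'k) mpoly) = keys (mon m' :: ('x, 'k) mpoly)"
    by simp
  then show "m = m'" by simp
qed

lemma mon_add: "mon (a + b) = (mon a * mon b :: ('x, 'k::field) mpoly)"
  by (simp add: mult_single)

lemma span_mult_closed: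
  fixes q :: "('x, 'k::field) mpoly"
  assumes "p \<in> mpoly.span S" "\<And>s. s \<in> S \<Longrightarrow> q * s \<in> mpoly.span T"
  shows "q * p \<in> mpoly.span T"
  using assms(1)
proof (induction rule: mpoly.span_induct_alt)
  case (step c x y)
  have "q * (mconst c * x + y) = mconst c * (q * x) + q * y"
    by (simp add: algebra_simps)
  then show ?case
    using step assms(2) by (auto intro!: mpoly.span_add mpoly.span_scale)
qed (simp add: mpoly.span_zero)

definition lin_ext :: "(('x \<Rightarrow>\<^sub>0 nat) \<Rightarrow> ('y, 'k) mpoly) \<Rightarrow> ('x, 'k::field) mpoly \<Rightarrow> ('y, 'k) mpoly" where
  "lin_ext f p = (\<Sum>m \<in> keys p. mconst (lookup p m) * f m)"

lemma lin_ext_superset: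
  assumes "finite A" "keys p \<subseteq> A"
  shows "lin_ext f p = (\<Sum>m \<in> A. mconst (lookup p m) * f m)"
  unfolding lin_ext_def
  by (rule sum.mono_neutral_left) (use assms in \<open>auto simp: in_keys_iff mconst_def\<close>)

lemma lin_ext_add: "lin_ext f (p + q) = lin_ext f p + lin_ext f q"
proof -
  let ?A = "keys p \<union> keys q"
  have "lin_ext f (p + q) = (\<Sum>m \<in> ?A. mconst (lookup (p + q) m) * f m)"
    by (rule lin_ext_superset) (use Poly_Mapping.keys_add [of p q] in auto)
  also have "\<dots> = lin_ext f p + lin_ext f q"
    by (subst (1 2) lin_ext_superset [of ?A])
      (auto simp: lookup_add mpoly.scale_left_distrib sum.distrib)
  finally show ?thesis .
qed

lemma lin_ext_scale: "lin_ext f (mconst c * p) = mconst c * lin_ext f p"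
proof -
  have "lin_ext f (mconst c * p)
      = (\<Sum>m \<in> keys p. mconst (lookup (mconst c * p) m) * f m)"
    by (rule lin_ext_superset) (auto simp: in_keys_iff)
  also have "\<dots> = mconst c * lin_ext f p"
    by (simp add: lin_ext_def sum_distrib_left mpoly.scale_scale [symmetric] del: mpoly.scale_scale)
  finally show ?thesis .
qed

lemma lin_ext_zero [simp]: "lin_ext f 0 = 0"
  by (simp add: lin_ext_def)

lemma lin_ext_minus: "lin_ext f (p - q) = lin_ext f p - lin_ext f q"
  using lin_ext_add [of f "p - q" q] by (simp add: algebra_simps)

lemma lin_ext_mon [simp]: "lin_ext f (mon m) = f m"
  by (simp add: lin_ext_def mconst_def)

lemma lin_ext_in_span:
  assumes "p \<in> mpoly.span S" "\<And>s. s \<in> S \<Longrightarrow> lin_ext f s \<in> mpoly.span T"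
  shows "lin_ext f p \<in> mpoly.span T"
  using assms(1)
  by (induction rule: mpoly.span_induct_alt)
    (auto simp: lin_ext_add lin_ext_scale mpoly.span_zero assms(2) intro!: mpoly.span_add mpoly.span_scale)

text \<open>For \<open>g = 0\<close> this says that a linear map that kills the monomial multiples of a monomial kills
  all its multiples.\<close>

lemma lin_ext_mult_mon:
  assumes "\<And>m'. f (m + m') = g * h m'"
  shows "lin_ext f (mon m * q) = g * lin_ext h q"
proof -
  show ?thesis
    using mem_span_mon [of q]
  proof (induction rule: mpoly.span_induct_alt)
    case (step c x y)
    then obtain m' where "x = mon m'" by blast
    then show ?case
      using step.IH
      by (simp add: lin_ext_add lin_ext_scale distrib_left mult.left_commute [of _ "mconst _"]
          mult_single assms del: mconst_mult_single)
  qed simp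
qed

lemma lin_ext_mult:
  assumes f: "\<And>m m'. f (m + m') = f m * f m'"
  shows "lin_ext f (p * q) = lin_ext f p * lin_ext f q"
proof -
  have mon: "lin_ext f (mon m * q) = f m * lin_ext f q" for m
    by (rule lin_ext_mult_mon) (rule f)
  show ?thesis
    using mem_span_mon [of p]
  proof (induction rule: mpoly.span_induct_alt)
    case base
    show ?case by simp
  next
    case (step c x y)
    then obtain m where x: "x = mon m" by blast
    have "lin_ext f ((mconst c * x + y) * q) = lin_ext f (mconst c * (mon m * q) + y * q)"
      by (simp only: x distrib_right mult.assoc)
    also have "\<dots> = mconst c * (f m * lin_ext f q) + lin_ext f y * lin_ext f q"
      by (simp only: lin_ext_add lin_ext_scale step.IH mon)
    also have "\<dots> = lin_ext f (mconst c * x + y) * lin_ext f q"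
      by (simp only: x lin_ext_add lin_ext_scale lin_ext_mon distrib_right mult.assoc)
    finally show ?case .
  qed
qed

lemma split_off_power:
  fixes m :: "'x \<Rightarrow>\<^sub>0 nat"
  assumes "k \<le> lookup m x"
  obtains m' where "m = single x k + m'" "keys m' \<subseteq> keys m"
    "\<forall>y. y \<noteq> x \<longrightarrow> lookup m' y = lookup m y"
proof
  let ?m' = "m - single x k"
  have look: "lookup ?m' y = lookup m y - (if x = y then k else 0)" for y
    by (simp add: lookup_minus lookup_single when_def)
  show "m = single x k + ?m'"
    using assms by (intro poly_mapping_eqI) (auto simp: lookup_add look lookup_single when_def)
  show "keys ?m' \<subseteq> keys m"
    by (rule subsetI) (simp add: in_keys_iff look)
  show "\<forall>y. y \<noteq> x \<longrightarrow> lookup ?m' y = lookup m y"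
    by (simp add: look)
qed

section \<open>Ideals of polynomial rings\<close>

lemma mult_mem_mpoly_ring:
  assumes "p \<in> carrier (mpoly_ring X)" "q \<in> carrier (mpoly_ring X)"
  shows "p * q \<in> carrier (mpoly_ring X)"
  unfolding mem_mpoly_ring_iff
proof
  fix m assume "m \<in> keys (p * q)"
  then obtain a b where "m = a + b" "a \<in> keys p" "b \<in> keys q"
    using keys_mult [of p q] by auto
  with assms show "keys m \<subseteq> X"
    using keys_subset_add by (metis mem_mpoly_ring_iff)
qed

lemma cring_mpoly_ring: "cring (mpoly_ring X :: ('x, 'k::field) mpoly ring)"
proof (rule cringI)
  note sub = mpoly.subspace_add [OF subspace_mpoly_ring]
    mpoly.subspace_neg [OF subspace_mpoly_ring]
    mpoly.subspace_0 [OF subspace_mpoly_ring]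
  show "abelian_group (mpoly_ring X :: ('x, 'k) mpoly ring)"
  proof (rule abelian_groupI, goal_cases)
    case (6 p)
    then show ?case
      using sub by (intro bexI [of _ "- p"]) auto
  qed (auto simp: sub add.assoc add.commute)
  show "Group.comm_monoid (mpoly_ring X :: ('x, 'k) mpoly ring)"
    by (rule comm_monoidI) (auto simp: mult_mem_mpoly_ring mult.assoc mult.commute,
        simp add: mem_mpoly_ring_iff)
qed (simp add: distrib_right)

lemma ring_mpoly_ring: "ring (mpoly_ring X)"
  using cring_mpoly_ring by (rule cring.axioms)

lemma mon_mem_mpoly_ring: "keys m \<subseteq> X \<Longrightarrow> mon m \<in> carrier (mpoly_ring X)"
  by (simp add: mem_mpoly_ring_iff)

lemma mconst_mem_mpoly_ring: "mconst a \<in> carrier (mpoly_ring X)"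
  by (auto simp: mem_mpoly_ring_iff mconst_def split: if_splits)

lemma subspace_ideal:
  assumes "ideal K (mpoly_ring X)"
  shows "mpoly.subspace K"
proof -
  note K = ideal.axioms(1) [OF assms]
  show ?thesis
    using additive_subgroup.zero_closed [OF K] additive_subgroup.a_closed [OF K]
      ideal.I_l_closed [OF assms _ mconst_mem_mpoly_ring]
    by (intro mpoly.subspaceI) auto
qed

text \<open>A polynomial is a combination of monomials, so a subspace is an ideal as soon as it absorbs
  multiplication by monomials.\<close>

lemma ideal_mpoly_ringI:
  fixes K :: "('x, 'k::field) mpoly set"
  assumes K: "K \<subseteq> carrier (mpoly_ring X)" "mpoly.subspace K"
    and mult: "\<And>m p. keys m \<subseteq> X \<Longrightarrow> p \<in> K \<Longrightarrow> mon m * p \<in> K"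
  shows "ideal K (mpoly_ring X)"
proof -
  interpret cring "mpoly_ring X :: ('x, 'k) mpoly ring" by (rule cring_mpoly_ring)
  have "subgroup K (add_monoid (mpoly_ring X))"
  proof (rule add.subgroupI)
    show "K \<noteq> {}" using mpoly.subspace_0 [OF K(2)] by blast
    fix p assume p: "p \<in> K"
    then have "- p \<in> K" by (rule mpoly.subspace_neg [OF K(2)])
    moreover from this p K(1) have "\<ominus>\<^bsub>mpoly_ring X\<^esub> p = - p"
      by (intro minus_equality) auto
    ultimately show "\<ominus>\<^bsub>mpoly_ring X\<^esub> p \<in> K" by simp
  qed (use K mpoly.subspace_add in auto)
  moreover have "q * p \<in> K" if "p \<in> K" "q \<in> carrier (mpoly_ring X)" for p q
  proof -
    have "p * q \<in> mpoly.span K"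
      using that(2) unfolding carrier_mpoly_ring
      by (rule span_mult_closed) (use mult that(1) mpoly.span_base in \<open>auto simp: mult.commute [of p]\<close>)
    then show ?thesis
      using K(2) mpoly.span_eq_iff by (metis mult.commute)
  qed
  ultimately show ?thesis
    by (intro idealI ring_mpoly_ring) (auto simp: mult.commute)
qed

section \<open>The toric homomorphism\<close>

text \<open>The exponent vector of the image of a monomial under the toric homomorphism.\<close>

definition vertex_degrees :: "('v, 'e) edge_graph \<Rightarrow> ('e \<Rightarrow>\<^sub>0 nat) \<Rightarrow> ('v \<Rightarrow>\<^sub>0 nat)" where
  "vertex_degrees G m =
    (\<Sum>e \<in> keys m. \<Sum>v \<in> ends G e. single v (lookup m e))"

definition mdeg :: "('x \<Rightarrow>\<^sub>0 nat) \<Rightarrow> nat" where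
  "mdeg m = (\<Sum>x \<in> keys m. lookup m x)"

lemma mdeg_superset:
  assumes "finite A" "keys m \<subseteq> A"
  shows "mdeg m = (\<Sum>x \<in> A. lookup m x)"
  unfolding mdeg_def
  by (rule sum.mono_neutral_left) (use assms in \<open>auto simp: in_keys_iff\<close>)

lemma mdeg_add: "mdeg (m + m') = mdeg m + mdeg m'"
proof -
  let ?A = "keys m \<union> keys m'"
  show ?thesis
    using Poly_Mapping.keys_add [of m m']
    by (simp add: mdeg_superset [of ?A] lookup_add sum.distrib)
qed

lemma mdeg_single [simp]: "mdeg (single x k) = k"
  by (simp add: mdeg_def)

lemma mdeg_zero [simp]: "mdeg 0 = 0"
  by (simp add: mdeg_def)

lemma mdeg_eq_0_iff: "mdeg m = 0 \<longleftrightarrow> m = 0"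
proof
  assume "mdeg m = 0"
  then have "\<forall>x \<in> keys m. lookup m x = 0" by (simp add: mdeg_def)
  then have "lookup m x = 0" for x by (cases "x \<in> keys m") (auto simp: in_keys_iff)
  then show "m = 0" by (intro poly_mapping_eqI) simp
qed simp

lemma vertex_degrees_superset:
  assumes "finite A" "keys m \<subseteq> A"
  shows "vertex_degrees G m
    = (\<Sum>e \<in> A. \<Sum>v \<in> ends G e. single v (lookup m e))"
  unfolding vertex_degrees_def
  by (rule sum.mono_neutral_left) (use assms in \<open>auto simp: in_keys_iff\<close>)

lemma vertex_degrees_add: "vertex_degrees G (m + m') = vertex_degrees G m + vertex_degrees G m'"
proof -
  let ?A = "keys m \<union> keys m'"
  show ?thesis
    using Poly_Mapping.keys_add [of m m']
    by (simp add: vertex_degrees_superset [of ?A] lookup_add single_add sum.distrib)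
qed

lemma vertex_degrees_zero [simp]: "vertex_degrees G 0 = 0"
  by (simp add: vertex_degrees_def)

lemma vertex_degrees_single:
  "vertex_degrees G (single e k) = (\<Sum>v \<in> ends G e. single v k)"
  by (simp add: vertex_degrees_def)

lemma lookup_vertex_degrees:
  assumes "finite A" "keys m \<subseteq> A" "\<And>e. e \<in> A \<Longrightarrow> finite (ends G e)"
  shows "lookup (vertex_degrees G m) v
    = (\<Sum>e \<in> {e \<in> A. v \<in> ends G e}. lookup m e)"
proof -
  have "lookup (vertex_degrees G m) v
      = (\<Sum>e \<in> A. if v \<in> ends G e then lookup m e else 0)"
    using assms
    by (auto simp: vertex_degrees_superset lookup_sum lookup_single when_def intro!: sum.cong)
  also have "\<dots> = (\<Sum>e \<in> {e \<in> A. v \<in> ends G e}. lookup m e)"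
    using assms(1) by (simp add: sum.inter_filter)
  finally show ?thesis .
qed

lemma mdeg_sum: "mdeg (sum f A) = (\<Sum>a \<in> A. mdeg (f a))"
  by (induction A rule: infinite_finite_induct) (auto simp: mdeg_add)

lemma keys_sum_subset: "keys (sum f A) \<subseteq> (\<Union>a \<in> A. keys (f a))"
proof
  fix x assume "x \<in> keys (sum f A)"
  then have "(\<Sum>a \<in> A. lookup (f a) x) \<noteq> 0"
    by (simp add: in_keys_iff lookup_sum)
  then obtain a where "a \<in> A" "lookup (f a) x \<noteq> 0"
    by (rule sum.not_neutral_contains_not_neutral)
  then show "x \<in> (\<Union>a \<in> A. keys (f a))"
    by (auto simp: in_keys_iff)
qed

lemma prod_mon: "(\<Prod>a \<in> A. mon (f a)) = (mon (\<Sum>a \<in> A. f a) :: ('x, 'k::field) mpoly)"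
  by (induction A rule: infinite_finite_induct) (auto simp: mult_single)

lemma mvar_power: "mvar x ^ k = (mon (single x k) :: ('x, 'k::field) mpoly)"
proof (induction k)
  case (Suc k)
  have "mvar x ^ Suc k = mon (single x 1) * (mon (single x k) :: ('x, 'k) mpoly)"
    by (simp only: power_Suc Suc.IH) (simp only: mvar_def)
  also have "\<dots> = mon (single x (1 + k))"
    by (simp only: mult_single single_add mult_1)
  finally show ?case by simp
qed simp

text \<open>The toric homomorphism sends monomials to monomials, so it is determined by the additive map
  \<open>vertex_degrees\<close> on exponent vectors.\<close>

lemma toric_hom_eq:
  "(toric_hom G :: ('e, 'k::field) mpoly \<Rightarrow> _) = lin_ext (\<lambda>m. mon (vertex_degrees G m))"
proof
  fix p :: "('e, 'k) mpoly"
  show "toric_hom G p = lin_ext (\<lambda>m. mon (vertex_degrees G m)) p"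
    by (simp add: toric_hom_def mpoly_subst_def lin_ext_def vertex_degrees_def mvar_power
        prod_mon prod_power_distrib)
qed

lemma toric_hom_mon: "toric_hom G (mon m) = mon (vertex_degrees G m)"
  by (simp add: toric_hom_eq)

lemma toric_hom_add: "toric_hom G (p + q) = toric_hom G p + toric_hom G q"
  by (simp add: toric_hom_eq lin_ext_add)

lemma toric_hom_one: "toric_hom G 1 = 1"
  using toric_hom_mon [of G 0] by simp

lemma toric_hom_mult: "toric_hom G (p * q) = toric_hom G p * toric_hom G q"
  unfolding toric_hom_eq by (rule lin_ext_mult) (simp add: vertex_degrees_add mult_single)

lemma keys_vertex_degrees:
  assumes "keys m \<subseteq> E" "\<And>e. e \<in> E \<Longrightarrow> ends G e \<subseteq> V"
  shows "keys (vertex_degrees G m) \<subseteq> V"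
proof -
  have "keys (\<Sum>v \<in> ends G e. single v (lookup m e)) \<subseteq> V"
    if "e \<in> keys m" for e
    using assms that by (intro order.trans [OF keys_sum_subset]) (auto split: if_splits)
  then show ?thesis
    unfolding vertex_degrees_def by (intro order.trans [OF keys_sum_subset]) blast
qed

lemma toric_hom_mem:
  fixes G :: "('v, 'e) edge_graph" and p :: "('e, 'k::field) mpoly"
  assumes "p \<in> carrier (mpoly_ring E)" "\<And>e. e \<in> E \<Longrightarrow> ends G e \<subseteq> V"
  shows "toric_hom G p \<in> carrier (mpoly_ring V)"
  unfolding toric_hom_eq carrier_mpoly_ring
proof (rule lin_ext_in_span [OF assms(1) [unfolded carrier_mpoly_ring]])
  fix s :: "('e, 'k) mpoly" assume "s \<in> mon ` {m. keys m \<subseteq> E}"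
  then obtain m where "s = mon m" "keys m \<subseteq> E" by blast
  then show "lin_ext (\<lambda>m. mon (vertex_degrees G m)) s
      \<in> mpoly.span (mon ` {m. keys m \<subseteq> V} :: ('v, 'k) mpoly set)"
    using keys_vertex_degrees [of m E G V] assms(2) by (auto intro: mpoly.span_base)
qed

lemma mem_toric_ideal_iff:
  "p \<in> toric_ideal G \<longleftrightarrow> p \<in> carrier (mpoly_ring (edges G)) \<and> toric_hom G p = 0"
  by (simp add: toric_ideal_def a_kernel_def' )

lemma ideal_toric_ideal:
  assumes "\<And>e. e \<in> edges G \<Longrightarrow> ends G e \<subseteq> verts G"
  shows "ideal (toric_ideal G) (mpoly_ring (edges G))"
proof -
  have "ring_hom_ring (mpoly_ring (edges G)) (mpoly_ring (verts G)) (toric_hom G)"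
    by (rule ring_hom_ringI)
      (simp_all add: ring_mpoly_ring toric_hom_mult toric_hom_add toric_hom_one toric_hom_mem [OF _ assms])
  then show ?thesis
    unfolding toric_ideal_def by (rule ring_hom_ring.kernel_is_ideal)
qed

section \<open>Length of an iterated quotient\<close>

lemma submodule_self_module_iff:
  assumes "cring A"
  shows "submodule N A (self_module A) \<longleftrightarrow> ideal N A"
proof -
  interpret cring A by fact
  have add: "subgroup N (add_monoid (self_module A)) \<longleftrightarrow> subgroup N (add_monoid A)"
    by (simp add: subgroup_def m_inv_def self_module_def)
  show ?thesis
  proof
    assume N: "submodule N A (self_module A)"
    then have sub: "subgroup N (add_monoid A)"
      using submodule.axioms(1) add by metis
    moreover have "x \<otimes>\<^bsub>A\<^esub> a \<in> N" if "a \<in> N" "x \<in> carrier A" for a x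
      using submodule.smult_closed [OF N that(2,1)] by (simp add: self_module_def)
    moreover have "a \<otimes>\<^bsub>A\<^esub> x = x \<otimes>\<^bsub>A\<^esub> a" if "a \<in> N" "x \<in> carrier A" for a x
      using subgroup.mem_carrier [OF sub that(1)] that(2) by (simp add: m_comm)
    ultimately show "ideal N A"
      by (intro idealI ring_axioms) metis+
  next
    assume N: "ideal N A"
    show "submodule N A (self_module A)"
      by (intro submodule.intro submodule_axioms.intro)
        (use ideal.I_l_closed [OF N] additive_subgroup.a_subgroup [OF ideal.axioms(1) [OF N]] in
          \<open>auto simp: add, simp add: self_module_def\<close>)
  qed
qed

text \<open>Keeping the set \<open>S\<close> of prescribed elements as a parameter makes chains in a quotient
  comparable with chains in the ring itself.\<close>

definition ideal_chain :: "('a, 'r) ring_scheme \<Rightarrow> 'a set \<Rightarrow> nat \<Rightarrow> (nat \<Rightarrow> 'a set) \<Rightarrow> bool" where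
  "ideal_chain P S n N \<longleftrightarrow> (\<forall>i\<le>n. ideal (N i) P \<and> S \<subseteq> N i) \<and> (\<forall>i<n. N i \<subset> N (Suc i))"

text \<open>Preimage and image under the projection are mutually inverse bijections between the ideals
  of the quotient and the ideals that contain \<open>I\<close>, so strictness of inclusions is preserved in
  both directions.\<close>

lemma ideal_chain_quotient:
  assumes P: "cring P" and I: "ideal I P" and X: "X \<subseteq> carrier P"
  shows "(\<exists>N. ideal_chain (P Quot I) ((+>\<^bsub>P\<^esub>) I ` X) n N) \<longleftrightarrow> (\<exists>N. ideal_chain P (I \<union> X) n N)"
    (is "?L \<longleftrightarrow> ?R")
proof -
  interpret cring P by fact
  let ?\<pi> = "(+>\<^bsub>P\<^esub>) I"
  have hom: "ring_hom_ring P (P Quot I) ?\<pi>" by (rule ideal.rcos_ring_hom_ring [OF I])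
  have vim: "ideal {r \<in> carrier P. ?\<pi> r \<in> J} P \<and> I \<subseteq> {r \<in> carrier P. ?\<pi> r \<in> J}
      \<and> ?\<pi> ` {r \<in> carrier P. ?\<pi> r \<in> J} = J" if J: "ideal J (P Quot I)" for J
  proof (intro conjI)
    show "ideal {r \<in> carrier P. ?\<pi> r \<in> J} P" by (rule ring_hom_ring.ideal_vimage [OF hom J])
    have zero: "I \<in> J"
      using additive_subgroup.zero_closed [OF ideal.axioms(1) [OF J]] by (simp add: FactRing_def)
    then show "I \<subseteq> {r \<in> carrier P. ?\<pi> r \<in> J}"
      using a_rcos_zero [OF I] ideal.Icarr [OF I] by auto
    have "J \<subseteq> ?\<pi> ` carrier P"
      using ideal.Icarr [OF J] by (auto simp: FactRing_def A_RCOSETS_def')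
    then show "?\<pi> ` {r \<in> carrier P. ?\<pi> r \<in> J} = J" by blast
  qed
  have img: "{r \<in> carrier P. ?\<pi> r \<in> ?\<pi> ` K} = K" if K: "ideal K P" "I \<subseteq> K" for K
  proof -
    have "r \<in> K" if r: "r \<in> carrier P" and s: "s \<in> K" and eq: "?\<pi> r = ?\<pi> s" for r s
    proof -
      have "additive_subgroup I P" using I by (rule ideal.axioms)
      then have "abelian_subgroup I P"
        by (rule abelian_subgroupI3) (rule abelian_group_axioms)
      then have "r \<in> ?\<pi> s"
        unfolding eq [symmetric] using r by (rule abelian_subgroup.a_rcos_self)
      then obtain i where i: "i \<in> I" "r = i \<oplus>\<^bsub>P\<^esub> s"
        unfolding a_r_coset_def' by blast
      show ?thesis
        unfolding i(2) using K(2) i(1) s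
        by (intro additive_subgroup.a_closed [OF ideal.axioms(1) [OF K(1)]]) (rule subsetD)
    qed
    then show ?thesis
      using ideal.Icarr [OF K(1)] by auto
  qed
  show ?thesis
  proof
    assume ?L
    then obtain N where N: "ideal_chain (P Quot I) (?\<pi> ` X) n N" by blast
    define M where "M i = {r \<in> carrier P. ?\<pi> r \<in> N i}" for i
    have N_ideal: "ideal (N i) (P Quot I)" "?\<pi> ` X \<subseteq> N i" if "i \<le> n" for i
      using N that by (simp_all add: ideal_chain_def)
    have "ideal (M i) P \<and> I \<union> X \<subseteq> M i" if "i \<le> n" for i
      unfolding M_def using vim [OF N_ideal(1) [OF that]] N_ideal(2) [OF that] X by blast
    moreover have "M i \<subset> M (Suc i)" if "i < n" for i
    proof -
      have N_less: "N i \<subset> N (Suc i)" using N that by (simp add: ideal_chain_def)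
      have im: "?\<pi> ` M i = N i" "?\<pi> ` M (Suc i) = N (Suc i)"
        unfolding M_def using vim [OF N_ideal(1)] that by simp_all
      have "M i \<noteq> M (Suc i)"
      proof
        assume "M i = M (Suc i)"
        then have "?\<pi> ` M i = ?\<pi> ` M (Suc i)" by (rule arg_cong)
        with im N_less show False by simp
      qed
      moreover have "M i \<subseteq> M (Suc i)" unfolding M_def using N_less by blast
      ultimately show ?thesis by (simp add: psubset_eq)
    qed
    ultimately have "ideal_chain P (I \<union> X) n M" by (simp add: ideal_chain_def)
    then show ?R by blast
  next
    assume ?R
    then obtain M where M: "ideal_chain P (I \<union> X) n M" by blast
    have M_ideal: "ideal (M i) P" "I \<subseteq> M i" "X \<subseteq> M i" if "i \<le> n" for i
      using M that by (simp_all add: ideal_chain_def)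
    have "ideal (?\<pi> ` M i) (P Quot I) \<and> ?\<pi> ` X \<subseteq> ?\<pi> ` M i" if "i \<le> n" for i
      using ring_ideal_imp_quot_ideal [OF I M_ideal(1)] M_ideal(3) that by blast
    moreover have "?\<pi> ` M i \<subset> ?\<pi> ` M (Suc i)" if "i < n" for i
    proof -
      have M_less: "M i \<subset> M (Suc i)" using M that by (simp add: ideal_chain_def)
      have "M i = {r \<in> carrier P. ?\<pi> r \<in> ?\<pi> ` M i}"
          "M (Suc i) = {r \<in> carrier P. ?\<pi> r \<in> ?\<pi> ` M (Suc i)}"
        using that by (intro img [symmetric] M_ideal(1,2); simp)+
      with M_less have "?\<pi> ` M i \<noteq> ?\<pi> ` M (Suc i)" by force
      then show ?thesis using image_mono [of "M i" "M (Suc i)" ?\<pi>] M_less by (simp add: psubset_eq)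
    qed
    ultimately have "ideal_chain (P Quot I) (?\<pi> ` X) n (\<lambda>i. ?\<pi> ` M i)"
      by (simp add: ideal_chain_def)
    then show ?L by blast
  qed
qed

lemma ideal_chain_Idl:
  assumes "ring P" "X \<subseteq> carrier P"
  shows "ideal_chain P (Idl\<^bsub>P\<^esub> X) n N \<longleftrightarrow> ideal_chain P X n N"
proof -
  interpret ring P by fact
  show ?thesis
    unfolding ideal_chain_def by (simp add: Idl_subset_ideal assms(2) cong: conj_cong)
qed

text \<open>By the correspondence theorem, applied twice, the chains of ideals of the iterated
  quotient are those of the ideals of \<open>P\<close> that contain both \<open>I\<close> and \<open>X\<close>.\<close>

lemma ring_length_iterated_quotient:
  fixes P :: "('a, 'r) ring_scheme"
  assumes P: "cring P" and I: "ideal I P" and X: "X \<subseteq> carrier P"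
  defines "R \<equiv> P Quot I"
  shows "ring_length (R Quot Idl\<^bsub>R\<^esub> ((+>\<^bsub>P\<^esub>) I ` X))
    = (SUP n \<in> {n. \<exists>N. ideal_chain P (I \<union> X) n N}. enat n)"
proof -
  interpret P: cring P by fact
  interpret R: cring R unfolding R_def by (rule ideal.quotient_is_cring [OF I P])
  let ?Y = "(+>\<^bsub>P\<^esub>) I ` X"
  have Y: "?Y \<subseteq> carrier R"
    using X by (auto simp: R_def FactRing_def A_RCOSETS_def')
  note J = R.genideal_ideal [OF Y]
  define A where "A = R Quot Idl\<^bsub>R\<^esub> ?Y"
  have A: "cring A" unfolding A_def by (rule ideal.quotient_is_cring [OF J R.is_cring])
  have "(\<exists>N. (\<forall>i\<le>n. submodule (N i) A (self_module A)) \<and> (\<forall>i<n. N i \<subset> N (Suc i)))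
      \<longleftrightarrow> (\<exists>N. ideal_chain P (I \<union> X) n N)" (is "?L n \<longleftrightarrow> _") for n
  proof -
    have "?L n \<longleftrightarrow> (\<exists>N. ideal_chain A ((+>\<^bsub>R\<^esub>) (Idl\<^bsub>R\<^esub> ?Y) ` {}) n N)"
      by (simp add: ideal_chain_def submodule_self_module_iff [OF A])
    also have "\<dots> \<longleftrightarrow> (\<exists>N. ideal_chain R (Idl\<^bsub>R\<^esub> ?Y \<union> {}) n N)"
      unfolding A_def by (rule ideal_chain_quotient [OF R.is_cring J]) simp
    also have "\<dots> \<longleftrightarrow> (\<exists>N. ideal_chain R ?Y n N)"
      by (simp add: ideal_chain_Idl [OF R.ring_axioms Y])
    also have "\<dots> \<longleftrightarrow> (\<exists>N. ideal_chain P (I \<union> X) n N)"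
      unfolding R_def by (rule ideal_chain_quotient [OF P I X])
    finally show ?thesis .
  qed
  then show ?thesis
    by (simp add: ring_length_def module_length_def A_def)
qed

section \<open>Sets without consecutive elements\<close>

text \<open>The supports of the normal forms.\<close>

definition sparse_sets :: "nat \<Rightarrow> nat set set" where
  "sparse_sets N = {T. T \<subseteq> {1..N} \<and> (\<forall>i \<in> T. Suc i \<notin> T)}"

lemma finite_sparse_sets: "finite (sparse_sets N)"
  by (rule finite_subset [of _ "Pow {1..N}"]) (auto simp: sparse_sets_def)

lemma sparse_sets_0: "sparse_sets 0 = {{}}"
  by (auto simp: sparse_sets_def)

lemma sparse_sets_1: "sparse_sets (Suc 0) = {{}, {Suc 0}}"
  by (auto simp: sparse_sets_def)

text \<open>A set without consecutive elements that contains \<open>N + 2\<close> does not contain \<open>N + 1\<close>; this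
  is the Fibonacci recursion.\<close>

lemma sparse_sets_Suc_Suc:
  "sparse_sets (Suc (Suc N)) = sparse_sets (Suc N) \<union> insert (Suc (Suc N)) ` sparse_sets N"
  (is "?A = ?B \<union> ?C")
proof
  show "?A \<subseteq> ?B \<union> ?C"
  proof
    fix T assume T: "T \<in> ?A"
    show "T \<in> ?B \<union> ?C"
    proof (cases "Suc (Suc N) \<in> T")
      case True
      with T have "Suc N \<notin> T" by (auto simp: sparse_sets_def)
      have "T - {Suc (Suc N)} \<subseteq> {1..N}"
      proof
        fix i assume i: "i \<in> T - {Suc (Suc N)}"
        with T have "1 \<le> i" "i \<le> Suc (Suc N)" by (auto simp: sparse_sets_def)
        moreover have "i \<noteq> Suc N" using i \<open>Suc N \<notin> T\<close> by auto
        ultimately show "i \<in> {1..N}" using i by auto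
      qed
      with T have "T - {Suc (Suc N)} \<in> sparse_sets N" by (auto simp: sparse_sets_def)
      moreover have "T = insert (Suc (Suc N)) (T - {Suc (Suc N)})" using True by blast
      ultimately show ?thesis by blast
    next
      case False
      have "T \<subseteq> {1..Suc N}"
      proof
        fix i assume "i \<in> T"
        with T False have "1 \<le> i" "i \<le> Suc (Suc N)" "i \<noteq> Suc (Suc N)"
          by (auto simp: sparse_sets_def)
        then show "i \<in> {1..Suc N}" by simp
      qed
      with T show ?thesis by (simp add: sparse_sets_def)
    qed
  qed
  show "?B \<union> ?C \<subseteq> ?A"
    by (fastforce simp: sparse_sets_def)
qed

lemma card_sparse_sets: "card (sparse_sets N) = fib (N + 2)"
proof (induction N rule: fib.induct)
  case (3 N)
  have "Suc (Suc N) \<notin> T" if "T \<in> sparse_sets N \<or> T \<in> sparse_sets (Suc N)" for T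
    using that by (auto simp: sparse_sets_def)
  then have "sparse_sets (Suc N) \<inter> insert (Suc (Suc N)) ` sparse_sets N = {}"
      and "inj_on (insert (Suc (Suc N))) (sparse_sets N)"
    by (auto simp: inj_on_def) (metis insert_ident)+
  then show ?case
    using 3 by (simp add: sparse_sets_Suc_Suc card_Un_disjoint finite_sparse_sets card_image)
qed (simp_all add: sparse_sets_0 sparse_sets_1)

text \<open>The normal form with support \<open>T\<close>; of the two variables \<open>x(2i)\<close> and \<open>x(2i + 1)\<close> that
  are identified, the odd one represents the class.\<close>

definition odd_mon :: "nat set \<Rightarrow> (nat \<Rightarrow>\<^sub>0 nat)" where
  "odd_mon T = (\<Sum>i \<in> T. single (2 * i + 1) 1)"

lemma lookup_odd_mon_odd: "finite T \<Longrightarrow> lookup (odd_mon T) (2 * i + 1) = (if i \<in> T then 1 else 0)"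
  by (simp add: odd_mon_def lookup_sum lookup_single when_def)

lemma lookup_odd_mon_even: "lookup (odd_mon T) (2 * i) = 0"
proof -
  have "2 * j + 1 \<noteq> 2 * i" for j :: nat by presburger
  then show ?thesis
    unfolding odd_mon_def lookup_sum lookup_single by (intro sum.neutral) (simp add: when_def)
qed

lemma mdeg_odd_mon: "mdeg (odd_mon T) = card T"
  by (simp add: odd_mon_def mdeg_sum)

text \<open>The termination measure of the rewriting. Powers of 3 make every rule increase it:
  \<open>3\<^bsup>2i\<^esup> < 3\<^bsup>2i+1\<^esup>\<close>, \<open>2 * 3\<^bsup>2i+1\<^esup> < 3\<^bsup>2i+2\<^esup>\<close> and \<open>3\<^bsup>2i+1\<^esup> + 3\<^bsup>2i+3\<^esup> < 3\<^bsup>2i+4\<^esup>\<close>.\<close>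

definition weight :: "(nat \<Rightarrow>\<^sub>0 nat) \<Rightarrow> nat" where
  "weight m = (\<Sum>x \<in> keys m. lookup m x * 3 ^ x)"

lemma weight_superset:
  assumes "finite A" "keys m \<subseteq> A"
  shows "weight m = (\<Sum>x \<in> A. lookup m x * 3 ^ x)"
  unfolding weight_def
  by (rule sum.mono_neutral_left) (use assms in \<open>auto simp: in_keys_iff\<close>)

lemma weight_add: "weight (m + m') = weight m + weight m'"
proof -
  let ?A = "keys m \<union> keys m'"
  show ?thesis
    using Poly_Mapping.keys_add [of m m']
    by (simp add: weight_superset [of ?A] lookup_add sum.distrib distrib_right)
qed

lemma weight_single [simp]: "weight (single x k) = k * 3 ^ x"
  by (simp add: weight_def)

lemma weight_le: "keys m \<subseteq> {..N} \<Longrightarrow> weight m \<le> mdeg m * 3 ^ N"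
  unfolding weight_def mdeg_def sum_distrib_right
  by (intro sum_mono mult_left_mono power_increasing) auto

section \<open>A growth comparison\<close>

text \<open>Iterating the inequality gives \<open>F\<^bsup>j\<^esup> N(0) \<le> s\<^bsup>j\<^esup> N(j c)\<close>. If \<open>s < F\<close>, the
  polynomially bounded \<open>N\<close> would have to grow like \<open>(F / s)\<^bsup>j\<^esup>\<close>.\<close>

lemma growth_comparison:
  fixes N :: "nat \<Rightarrow> nat"
  assumes N: "\<And>d. F * N d \<le> s * N (d + c)" "N 0 > 0" "\<And>d. N d \<le> (d + 1) ^ c" and c: "c > 0"
  shows "F \<le> s"
proof (rule ccontr)
  assume "\<not> F \<le> s"
  then have F: "s < F" by simp
  have iterated: "F ^ j * N 0 \<le> s ^ j * N (j * c)" for j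
  proof (induction j)
    case (Suc j)
    have "F ^ Suc j * N 0 \<le> F * (s ^ j * N (j * c))"
      using Suc.IH by simp
    also have "\<dots> = s ^ j * (F * N (j * c))" by simp
    also have "\<dots> \<le> s ^ j * (s * N (j * c + c))"
      by (intro mult_left_mono N) simp
    finally show ?case by (simp add: algebra_simps)
  qed simp
  have "s > 0"
    using iterated [of 1] F N(2) by (cases s) auto
  define a where "a = real F / real s"
  have a: "a > 1" using F \<open>s > 0\<close> by (simp add: a_def)
  have bound: "a ^ j \<le> (real j * real c + 1) ^ c" for j
  proof -
    have "F ^ j \<le> F ^ j * N 0" using N(2) by simp
    also have "\<dots> \<le> s ^ j * N (j * c)" by (rule iterated)
    also have "\<dots> \<le> s ^ j * (j * c + 1) ^ c" by (intro mult_left_mono N) simp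
    finally have "real (F ^ j) \<le> real (s ^ j * (j * c + 1) ^ c)" by (simp only: of_nat_le_iff)
    then show ?thesis
      using \<open>s > 0\<close> by (simp add: a_def power_divide field_simps)
  qed
  define C where "C = real c"
  have "C > 0" using c by (simp add: C_def)
  then have "(\<lambda>j::nat. (real j * C + 1) powr C / a powr real j) \<longlonglongrightarrow> 0"
    using a by real_asymp
  then have "(\<lambda>j. (real j * real c + 1) ^ c / a ^ j) \<longlonglongrightarrow> 0"
    using a by (simp add: C_def powr_realpow add_nonneg_pos)
  then have "eventually (\<lambda>j. (real j * real c + 1) ^ c / a ^ j < 1) sequentially"
    by (rule order_tendstoD) simp
  then obtain j where "(real j * real c + 1) ^ c / a ^ j < 1"
    by (auto simp: eventually_sequentially)
  then have "(real j * real c + 1) ^ c < a ^ j"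
    using a by simp
  with bound [of j] show False by simp
qed

section \<open>Toric rings with the combinatorics of a ladder\<close>

text \<open>What the argument needs to know about the graph. The two relations come from 4-cycles
  in which \<open>x(2i)\<close>, \<open>x(2i + 1)\<close>, respectively \<open>x(2i + 1)\<close>, \<open>x(2i + 3)\<close>, are opposite
  edges and \<open>x(2i + 2)\<close>, respectively \<open>x(2i + 4)\<close>, is a third edge. In the last assumption
  \<open>a\<close> is the vertex that the construction adds together with the edges \<open>x(2i + 3)\<close> and
  \<open>x(2i + 4)\<close>, and \<open>b\<close> is the vertex added just before it; for \<open>i = 0\<close> the number
  \<open>2i + 1 = 1\<close> is not the index of an edge.\<close>

locale ladder_toric =
  fixes n :: nat and G :: "('v, nat) edge_graph"
  assumes edges_eq: "edges G = {0} \<union> {2..2 * n + 4}"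
    and ends_subset: "\<And>e. e \<in> edges G \<Longrightarrow> ends G e \<subseteq> verts G"
    and card_ends: "\<And>e. e \<in> edges G \<Longrightarrow> card (ends G e) = 2"
    and square_relation: "\<And>i. i \<in> {1..n + 1} \<Longrightarrow> \<exists>f \<in> edges G.
      vertex_degrees G (single (2 * i) 1 + single (2 * i + 1) 1) =
      vertex_degrees G (single (2 * i + 2) 1 + single f 1)"
    and adjacent_relation: "\<And>i. i \<in> {1..n} \<Longrightarrow> \<exists>f \<in> edges G.
      vertex_degrees G (single (2 * i + 1) 1 + single (2 * i + 3) 1) =
      vertex_degrees G (single (2 * i + 4) 1 + single f 1)"
    and separating_vertices: "\<And>i. i \<le> n \<Longrightarrow> \<exists>a b. \<forall>e \<in> edges G. e \<le> 2 * i + 4 \<longrightarrow>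
      (a \<in> ends G e \<longleftrightarrow> e \<in> {2 * i + 3, 2 * i + 4}) \<and>
      (b \<in> ends G e \<longleftrightarrow> e \<in> {2 * i + 1, 2 * i + 2, 2 * i + 4})"
begin

lemma finite_edges [simp]: "finite (edges G)"
  by (simp add: edges_eq)

lemma finite_ends: "e \<in> edges G \<Longrightarrow> finite (ends G e)"
  using card_ends card.infinite by fastforce

lemma mdeg_vertex_degrees:
  assumes "keys m \<subseteq> edges G"
  shows "mdeg (vertex_degrees G m) = 2 * mdeg m"
proof -
  have "mdeg (vertex_degrees G m) = (\<Sum>e \<in> edges G. card (ends G e) * lookup m e)"
    by (simp add: vertex_degrees_superset [OF finite_edges assms] mdeg_sum)
  also have "\<dots> = (\<Sum>e \<in> edges G. 2 * lookup m e)"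
    by (rule sum.cong) (simp_all add: card_ends)
  also have "\<dots> = 2 * mdeg m"
    by (simp add: mdeg_superset [OF finite_edges assms] sum_distrib_left)
  finally show ?thesis .
qed

text \<open>The monomials that are divisible by none of the leading terms of the relations.\<close>

definition standard :: "(nat \<Rightarrow>\<^sub>0 nat) \<Rightarrow> bool" where
  "standard m \<longleftrightarrow> keys m \<subseteq> edges G \<and>
    (\<forall>i \<in> {1..n + 1}. lookup m (2 * i) = 0 \<or> lookup m (2 * i + 1) = 0) \<and>
    (\<forall>i \<in> {1..n}. lookup m (2 * i + 1) = 0 \<or> lookup m (2 * i + 3) = 0)"

lemma standard_odd_zero:
  assumes "standard m" "i \<le> n" "lookup m (2 * i + 3) \<noteq> 0"
  shows "lookup m (2 * i + 1) = 0" "lookup m (2 * i + 2) = 0"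
proof -
  have "lookup m (2 * (i + 1)) = 0 \<or> lookup m (2 * (i + 1) + 1) = 0"
  proof -
    have "\<forall>i \<in> {1..n + 1}. lookup m (2 * i) = 0 \<or> lookup m (2 * i + 1) = 0"
      using assms(1) unfolding standard_def by (elim conjE)
    then show ?thesis by (rule bspec) (use assms(2) in simp)
  qed
  moreover have "2 * (i + 1) = 2 * i + 2" "2 * (i + 1) + 1 = 2 * i + 3" by simp_all
  ultimately show "lookup m (2 * i + 2) = 0"
    using assms(3) by metis
  show "lookup m (2 * i + 1) = 0"
  proof (cases "i = 0")
    case True
    have "1 \<notin> edges G" by (simp add: edges_eq)
    then show ?thesis
      using assms(1) True by (auto simp: standard_def in_keys_iff)
  next
    case False
    then show ?thesis using assms by (auto simp: standard_def)
  qed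
qed

text \<open>The edges after \<open>k\<close> contribute equally to both vertex degrees, so the edges up to \<open>k\<close> can
  be compared alone.\<close>

lemma vertex_sums_eq:
  assumes m: "keys m \<subseteq> edges G" "keys m' \<subseteq> edges G"
    and eq: "vertex_degrees G m = vertex_degrees G m'"
    and later: "\<And>e. e > k \<Longrightarrow> lookup m e = lookup m' e"
    and S: "S \<subseteq> {..k}" "\<And>e. e \<in> edges G \<Longrightarrow> e \<le> k \<Longrightarrow> (v \<in> ends G e \<longleftrightarrow> e \<in> S)"
  shows "(\<Sum>e \<in> S. lookup m e) = (\<Sum>e \<in> S. lookup m' e)"
proof -
  let ?D = "{e \<in> edges G. v \<in> ends G e}"
  have split: "(\<Sum>e \<in> ?D. lookup p e)
      = (\<Sum>e \<in> S. lookup p e) + (\<Sum>e \<in> ?D \<inter> {k<..}. lookup p e)"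
    if p: "keys p \<subseteq> edges G" for p :: "nat \<Rightarrow>\<^sub>0 nat"
  proof -
    have "?D = (?D \<inter> {..k}) \<union> (?D \<inter> {k<..})" by auto
    then have "(\<Sum>e \<in> ?D. lookup p e)
        = (\<Sum>e \<in> ?D \<inter> {..k}. lookup p e) + (\<Sum>e \<in> ?D \<inter> {k<..}. lookup p e)"
      using sum.union_disjoint [of "?D \<inter> {..k}" "?D \<inter> {k<..}" "lookup p"]
      by (simp add: disjoint_iff)
    moreover have "(\<Sum>e \<in> ?D \<inter> {..k}. lookup p e) = (\<Sum>e \<in> S. lookup p e)"
    proof (rule sum.mono_neutral_left)
      show "finite S" using S(1) finite_subset by blast
      show "?D \<inter> {..k} \<subseteq> S" using S(2) by auto
      show "\<forall>e \<in> S - ?D \<inter> {..k}. lookup p e = 0"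
      proof
        fix e assume "e \<in> S - ?D \<inter> {..k}"
        then have "e \<notin> edges G" using S by auto
        then show "lookup p e = 0" using p by (auto simp: in_keys_iff)
      qed
    qed
    ultimately show ?thesis by simp
  qed
  have "(\<Sum>e \<in> ?D. lookup m e) = (\<Sum>e \<in> ?D. lookup m' e)"
    using lookup_vertex_degrees [OF finite_edges m(1) finite_ends, of v]
      lookup_vertex_degrees [OF finite_edges m(2) finite_ends, of v] eq by simp
  moreover have "(\<Sum>e \<in> ?D \<inter> {k<..}. lookup m e) = (\<Sum>e \<in> ?D \<inter> {k<..}. lookup m' e)"
    by (rule sum.cong) (auto simp: later)
  ultimately show ?thesis
    using split [OF m(1)] split [OF m(2)] by simp
qed

text \<open>Since the exponents of \<open>x(2i + 3)\<close> and \<open>x(2i + 4)\<close> have the same sum in \<open>m\<close> and \<open>m'\<close>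
  (vertex \<open>a\<close>), the variable \<open>x(2i + 3)\<close> divides \<open>m\<close>. Being standard, \<open>m\<close> then avoids
  \<open>x(2i + 1)\<close> and \<open>x(2i + 2)\<close>, so at the vertex \<open>b\<close> its degree is too small.\<close>

lemma standard_eqI_step:
  assumes m: "standard m" "standard m'" and eq: "vertex_degrees G m = vertex_degrees G m'"
    and later: "\<And>e. e > 2 * i + 4 \<Longrightarrow> lookup m e = lookup m' e"
    and i: "i \<le> n"
    and less: "lookup m (2 * i + 4) < lookup m' (2 * i + 4)"
  shows False
proof -
  obtain a b where ab: "\<And>e. e \<in> edges G \<Longrightarrow> e \<le> 2 * i + 4 \<Longrightarrow> (a \<in> ends G e \<longleftrightarrow> e \<in> {2 * i + 3, 2 * i + 4})"
      "\<And>e. e \<in> edges G \<Longrightarrow> e \<le> 2 * i + 4 \<Longrightarrow> (b \<in> ends G e \<longleftrightarrow> e \<in> {2 * i + 1, 2 * i + 2, 2 * i + 4})"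
    using separating_vertices [OF i] by blast
  have k: "keys m \<subseteq> edges G" "keys m' \<subseteq> edges G"
    using m by (simp_all add: standard_def)
  have "(\<Sum>e \<in> {2 * i + 3, 2 * i + 4}. lookup m e) = (\<Sum>e \<in> {2 * i + 3, 2 * i + 4}. lookup m' e)"
    by (rule vertex_sums_eq [OF k eq later _ ab(1)]) auto
  then have "lookup m (2 * i + 3) \<noteq> 0" using less by simp
  note z = standard_odd_zero [OF m(1) i this]
  have "(\<Sum>e \<in> {2 * i + 1, 2 * i + 2, 2 * i + 4}. lookup m e)
      = (\<Sum>e \<in> {2 * i + 1, 2 * i + 2, 2 * i + 4}. lookup m' e)"
    by (rule vertex_sums_eq [OF k eq later _ ab(2)]) auto
  then show False using less z by simp
qed

text \<open>The exponents are compared from the last edge downwards, two edges at a time. Of the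
  remaining edges, \<open>x(2)\<close> is the only one at the vertex \<open>b\<close> for \<open>i = 0\<close>, and the exponent of
  \<open>x(0)\<close> is determined by the total degree.\<close>

lemma standard_eqI:
  assumes m: "standard m" "standard m'" and eq: "vertex_degrees G m = vertex_degrees G m'"
  shows "m = m'"
proof -
  have k: "keys m \<subseteq> edges G" "keys m' \<subseteq> edges G"
    using m by (simp_all add: standard_def)
  have outside: "lookup m e = lookup m' e" if "e \<notin> edges G" for e
    using k that by (metis in_keys_iff subsetD)
  have step: "\<forall>e > 2 * i + 2. lookup m e = lookup m' e"
    if i: "i \<le> n" and IH: "\<forall>e > 2 * i + 4. lookup m e = lookup m' e" for i
  proof -
    have eq4: "lookup m (2 * i + 4) = lookup m' (2 * i + 4)"
      using standard_eqI_step [OF m eq _ i] standard_eqI_step [OF m(2,1) eq [symmetric] _ i] IH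
      by (metis linorder_neqE_nat)
    obtain a where a: "\<And>e. e \<in> edges G \<Longrightarrow> e \<le> 2 * i + 4 \<Longrightarrow> (a \<in> ends G e \<longleftrightarrow> e \<in> {2 * i + 3, 2 * i + 4})"
      using separating_vertices [OF i] by blast
    have "(\<Sum>e \<in> {2 * i + 3, 2 * i + 4}. lookup m e) = (\<Sum>e \<in> {2 * i + 3, 2 * i + 4}. lookup m' e)"
      by (rule vertex_sums_eq [OF k eq IH [rule_format] _ a]) auto
    with eq4 have eq3: "lookup m (2 * i + 3) = lookup m' (2 * i + 3)" by simp
    show ?thesis
    proof (intro allI impI)
      fix e :: nat assume "2 * i + 2 < e"
      then consider "e = 2 * i + 3" | "e = 2 * i + 4" | "2 * i + 4 < e" by linarith
      then show "lookup m e = lookup m' e"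
        using eq3 eq4 IH by cases auto
    qed
  qed
  have "\<forall>e > 2 * (n + 1 - j) + 2. lookup m e = lookup m' e" if "j \<le> n + 1" for j
    using that
  proof (induction j)
    case 0
    show ?case by (auto intro!: outside simp: edges_eq)
  next
    case (Suc j)
    define i where "i = n - j"
    have i: "2 * (n + 1 - j) + 2 = 2 * i + 4" "n + 1 - Suc j = i" "i \<le> n"
      using Suc.prems by (auto simp: i_def)
    have "\<forall>e > 2 * i + 4. lookup m e = lookup m' e"
      using Suc.IH Suc.prems unfolding i(1) by simp
    then show ?case unfolding i(2) by (rule step [OF i(3)])
  qed
  from this [of "n + 1"] have later: "\<And>e. e > 2 \<Longrightarrow> lookup m e = lookup m' e"
    by simp
  have eq2: "lookup m 2 = lookup m' 2"
  proof -
    obtain b where b: "\<And>e. e \<in> edges G \<Longrightarrow> e \<le> 2 * 0 + 4 \<Longrightarrow> (b \<in> ends G e \<longleftrightarrow> e \<in> {2 * 0 + 1, 2 * 0 + 2, 2 * 0 + 4})"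
      using separating_vertices [of 0] by blast
    have "(\<Sum>e \<in> {2}. lookup m e) = (\<Sum>e \<in> {2}. lookup m' e)"
    proof (rule vertex_sums_eq [OF k eq later, of 2])
      show "b \<in> ends G e \<longleftrightarrow> e \<in> {2}" if "e \<in> edges G" "e \<le> 2" for e
        using b [of e] that by (auto simp: edges_eq)
    qed auto
    then show ?thesis by simp
  qed
  have pos: "lookup m e = lookup m' e" if e: "e \<noteq> 0" for e
  proof -
    consider "e = 1" | "e = 2" | "e > 2" using e by linarith
    then show ?thesis using outside [of 1] eq2 later by cases (auto simp: edges_eq)
  qed
  have "mdeg m = mdeg m'"
    using mdeg_vertex_degrees [OF k(1)] mdeg_vertex_degrees [OF k(2)] eq by simp
  then have "(\<Sum>e \<in> edges G. lookup m e) = (\<Sum>e \<in> edges G. lookup m' e)"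
    by (simp add: mdeg_superset [OF finite_edges] k)
  moreover have "(\<Sum>e \<in> edges G - {0}. lookup m e) = (\<Sum>e \<in> edges G - {0}. lookup m' e)"
    by (rule sum.cong) (auto simp: pos)
  moreover have "0 \<in> edges G" by (simp add: edges_eq)
  ultimately have "lookup m 0 = lookup m' 0"
    by (simp add: sum.remove [of _ 0])
  with pos show ?thesis
    by (intro poly_mapping_eqI) metis
qed

section \<open>Normal forms and the upper bound\<close>

lemma keys_odd_mon:
  assumes "T \<in> sparse_sets (n + 1)"
  shows "keys (odd_mon T) \<subseteq> edges G"
  unfolding odd_mon_def
proof (rule order.trans [OF keys_sum_subset], rule UN_least)
  fix i assume "i \<in> T"
  with assms have "1 \<le> i" "i \<le> n + 1" by (auto simp: sparse_sets_def)
  then show "keys (single (2 * i + 1) 1 :: nat \<Rightarrow>\<^sub>0 nat) \<subseteq> edges G"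
    by (simp add: edges_eq)
qed

abbreviation P :: "(nat, 'k::field) mpoly ring" where "P \<equiv> mpoly_ring (edges G)"

lemma toric_binomial:
  assumes "keys a \<subseteq> edges G" "keys b \<subseteq> edges G"
    and "vertex_degrees G a = vertex_degrees G b"
  shows "mon a - mon b \<in> (toric_ideal G :: (nat, 'k::field) mpoly set)"
proof -
  have "mon a - mon b \<in> carrier (P :: (nat, 'k) mpoly ring)"
    by (rule mpoly.subspace_diff [OF subspace_mpoly_ring]) (simp_all add: mon_mem_mpoly_ring assms)
  then show ?thesis
    by (simp add: mem_toric_ideal_iff toric_hom_eq lin_ext_minus assms(3))
qed

lemma mon_span_replace:
  fixes K :: "(nat, 'k::field) mpoly set"
  assumes K: "ideal K P" and ab: "mon a - mon b \<in> K" and m': "keys m' \<subseteq> edges G"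
    and b: "mon (b + m') \<in> mpoly.span (K \<union> S)"
  shows "mon (a + m') \<in> mpoly.span (K \<union> S)"
proof -
  have "mon m' * (mon a - mon b) \<in> K"
    using ideal.I_l_closed [OF K ab mon_mem_mpoly_ring [OF m']] by simp
  then have "mon m' * (mon a - mon b) + mon (b + m') \<in> mpoly.span (K \<union> S)"
    by (intro mpoly.span_add b mpoly.span_base) simp
  moreover have "mon m' * (mon a - mon b) + mon (b + m') = (mon (a + m') :: (nat, 'k) mpoly)"
    unfolding mon_add right_diff_distrib by (simp add: mult.commute)
  ultimately show ?thesis by simp
qed

lemma normal_form_odd_mon:
  assumes keys: "keys m \<subseteq> edges G"
    and ends: "lookup m 0 = 0" "lookup m (2 * n + 4) = 0"
    and even: "\<And>i. i \<in> {1..n + 1} \<Longrightarrow> lookup m (2 * i) = 0"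
    and square: "\<And>i. i \<in> {1..n + 1} \<Longrightarrow> lookup m (2 * i + 1) < 2"
    and adjacent: "\<And>i. i \<in> {1..n} \<Longrightarrow> lookup m (2 * i + 1) = 0 \<or> lookup m (2 * i + 3) = 0"
  shows "\<exists>T \<in> sparse_sets (n + 1). m = odd_mon T"
proof
  define T where "T = {i \<in> {1..n + 1}. lookup m (2 * i + 1) \<noteq> 0}"
  have fin: "finite T" by (simp add: T_def)
  show "T \<in> sparse_sets (n + 1)"
    unfolding sparse_sets_def
  proof (intro CollectI conjI ballI notI)
    show "T \<subseteq> {1..n + 1}" by (auto simp: T_def)
    fix i assume "i \<in> T" "Suc i \<in> T"
    then have "i \<in> {1..n}" "lookup m (2 * i + 1) \<noteq> 0" "lookup m (2 * Suc i + 1) \<noteq> 0"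
      unfolding T_def by simp_all
    moreover have "2 * Suc i + 1 = 2 * i + 3" by simp
    ultimately show False using adjacent by metis
  qed
  show "m = odd_mon T"
  proof (rule poly_mapping_eqI)
    fix x
    have out: "lookup m x = 0" if "x \<notin> edges G" for x
      using keys that by (metis in_keys_iff subsetD)
    show "lookup m x = lookup (odd_mon T) x"
    proof (cases "even x")
      case True
      then obtain i where x: "x = 2 * i" by blast
      have "lookup m x = 0"
      proof (cases "i \<in> {1..n + 1}")
        case True
        then show ?thesis using even x by simp
      next
        case False
        then have "x = 0 \<or> x = 2 * n + 4 \<or> x > 2 * n + 4" using x by auto
        then show ?thesis using ends out [of x] by (auto simp: edges_eq)
      qed
      then show ?thesis unfolding x lookup_odd_mon_even .
    next
      case False
      then obtain i where x: "x = 2 * i + 1" by (rule oddE)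
      show ?thesis
      proof (cases "i \<in> {1..n + 1}")
        case True
        have "lookup m x < 2" using square [OF True] x by simp
        moreover have "i \<in> T \<longleftrightarrow> lookup m x \<noteq> 0" using True x by (simp add: T_def)
        ultimately show ?thesis
          unfolding x lookup_odd_mon_odd [OF fin] by auto
      next
        case False
        then have "x \<notin> edges G" using x by (auto simp: edges_eq)
        moreover have "i \<notin> T" unfolding T_def using False by blast
        ultimately show ?thesis
          using out unfolding x lookup_odd_mon_odd [OF fin] by simp
      qed
    qed
  qed
qed

text \<open>The rewriting argument. Tracking the degree is what later makes the ideals in the chain
  closed under multiplication.\<close>

lemma mon_mem_span_normal_forms:
  fixes K :: "(nat, 'k::field) mpoly set"
  assumes K: "ideal K P" "toric_ideal G \<subseteq> K" "params_X TYPE('k) n \<subseteq> K"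
    and "keys m \<subseteq> edges G"
  shows "mon m \<in> mpoly.span (K \<union> mon ` odd_mon ` {T \<in> sparse_sets (n + 1). card T = mdeg m})"
  using assms(4)
proof (induction "mdeg m * 3 ^ (2 * n + 4) - weight m" arbitrary: m rule: less_induct)
  case less
  let ?S = "\<lambda>d. mon ` odd_mon ` {T \<in> sparse_sets (n + 1). card T = d} :: (nat, 'k) mpoly set"
  have le: "weight p \<le> mdeg p * 3 ^ (2 * n + 4)" if "keys p \<subseteq> edges G" for p
    by (rule weight_le [OF order.trans [OF that]]) (auto simp: edges_eq)
  have replace: "mon m \<in> mpoly.span (K \<union> ?S (mdeg m))"
    if m: "m = a + m'" and ab: "mon a - mon b \<in> K" and b: "keys b \<subseteq> edges G"
      and m': "keys m' \<subseteq> keys m" and deg: "mdeg b = mdeg a" and w: "weight a < weight b"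
    for a b m'
  proof -
    have m': "keys m' \<subseteq> edges G" using m' less.prems by (rule order.trans)
    have keys: "keys (b + m') \<subseteq> edges G" by (rule keys_subset_add [OF b m'])
    have deg': "mdeg (b + m') = mdeg m" by (simp add: m mdeg_add deg)
    have "weight m < weight (b + m')" by (simp add: m weight_add w)
    then have "mdeg (b + m') * 3 ^ (2 * n + 4) - weight (b + m') < mdeg m * 3 ^ (2 * n + 4) - weight m"
      using le [OF keys] unfolding deg' by linarith
    from less.hyps [OF this keys]
    have "mon (b + m') \<in> mpoly.span (K \<union> ?S (mdeg m))" unfolding deg' .
    from mon_span_replace [OF K(1) ab m' this] show ?thesis unfolding m .
  qed
  have X: "mvar 0 \<in> K" "mvar (2 * n + 4) \<in> K"
      "\<And>i. i \<in> {1..n + 1} \<Longrightarrow> mvar (2 * i) - mvar (2 * i + 1) \<in> K"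
    using K(3) unfolding params_X_def by (blast+)
  have E: "keys (single x k) \<subseteq> edges G" if "x \<in> edges G" for x and k :: nat
    using that by simp
  have zero: "mon m \<in> mpoly.span (K \<union> ?S (mdeg m))" if x: "mvar x \<in> K" "lookup m x \<noteq> 0" for x
  proof -
    have "1 \<le> lookup m x" using x(2) by simp
    then obtain m' where m': "m = single x 1 + m'" "keys m' \<subseteq> keys m"
        "\<forall>y. y \<noteq> x \<longrightarrow> lookup m' y = lookup m y"
      by (rule split_off_power)
    have "mon m' * mvar x \<in> K"
      using ideal.I_l_closed [OF K(1) x(1) mon_mem_mpoly_ring [OF order.trans [OF m'(2) less.prems]]] by simp
    moreover have "mon m = (mon m' * mvar x :: (nat, 'k) mpoly)"
      unfolding m'(1) mon_add by (simp add: mvar_def mult.commute)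
    ultimately show ?thesis by (simp add: mpoly.span_base)
  qed
  consider (ends) "lookup m 0 \<noteq> 0 \<or> lookup m (2 * n + 4) \<noteq> 0"
    | (even) i where "i \<in> {1..n + 1}" "lookup m (2 * i) \<noteq> 0"
    | (square) i where "i \<in> {1..n + 1}" "lookup m (2 * i + 1) \<ge> 2"
    | (adjacent) i where "i \<in> {1..n}" "lookup m (2 * i + 1) \<noteq> 0" "lookup m (2 * i + 3) \<noteq> 0"
    | (normal) "\<exists>T \<in> sparse_sets (n + 1). m = odd_mon T"
    using normal_form_odd_mon [OF less.prems] by (metis not_le)
  then show ?case
  proof cases
    case ends
    then show ?thesis using zero X(1,2) by metis
  next
    case (even i)
    then have "1 \<le> lookup m (2 * i)" by simp
    then obtain m' where m': "m = single (2 * i) 1 + m'" "keys m' \<subseteq> keys m"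
        "\<forall>y. y \<noteq> 2 * i \<longrightarrow> lookup m' y = lookup m y"
      by (rule split_off_power)
    show ?thesis
    proof (rule replace [OF m'(1) _ _ m'(2)])
      show "mon (single (2 * i) 1) - mon (single (2 * i + 1) 1) \<in> K"
        using X(3) [OF even(1)] by (simp add: mvar_def)
      show "keys (single (2 * i + 1) 1 :: nat \<Rightarrow>\<^sub>0 nat) \<subseteq> edges G"
        using even(1) by (intro E) (auto simp: edges_eq)
    qed simp_all
  next
    case (square i)
    from square(2)
    obtain m' where m': "m = single (2 * i + 1) 2 + m'" "keys m' \<subseteq> keys m"
        "\<forall>y. y \<noteq> 2 * i + 1 \<longrightarrow> lookup m' y = lookup m y"
      by (rule split_off_power)
    obtain f where f: "f \<in> edges G" "vertex_degrees G (single (2 * i) 1 + single (2 * i + 1) 1) =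
        vertex_degrees G (single (2 * i + 2) 1 + single f 1)"
      using square_relation [OF square(1)] by blast
    have iE: "2 * i \<in> edges G" "2 * i + 1 \<in> edges G" "2 * i + 2 \<in> edges G"
      using square(1) by (auto simp: edges_eq)
    let ?b = "single (2 * i + 2) 1 + single f 1 :: nat \<Rightarrow>\<^sub>0 nat"
    let ?c = "single (2 * i) 1 + single (2 * i + 1) 1 :: nat \<Rightarrow>\<^sub>0 nat"
    have b: "keys ?b \<subseteq> edges G" by (intro keys_subset_add E iE f)
    have c: "keys ?c \<subseteq> edges G" by (intro keys_subset_add E iE)
    show ?thesis
    proof (rule replace [OF m'(1) _ b m'(2)])
      \<comment> \<open>Modulo the linear forms \<open>x(2i + 1)\<^sup>2\<close> is \<open>x(2i) x(2i + 1)\<close>, to which the relation applies.\<close>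
      have "mon ?c - mon ?b \<in> K"
        using toric_binomial [OF c b f(2)] K(2) by (rule rev_subsetD)
      moreover have "mvar (2 * i + 1) * (mvar (2 * i) - mvar (2 * i + 1)) \<in> K"
        using ideal.I_l_closed [OF K(1) X(3) [OF square(1)] mon_mem_mpoly_ring [OF E [OF iE(2)]], of 1]
        by (simp add: mvar_def)
      ultimately have "(mon ?c - mon ?b) - mvar (2 * i + 1) * (mvar (2 * i) - mvar (2 * i + 1)) \<in> K"
        by (rule mpoly.subspace_diff [OF subspace_ideal [OF K(1)]])
      moreover have "mon (single (2 * i + 1) 2) = (mvar (2 * i + 1) * mvar (2 * i + 1) :: (nat, 'k) mpoly)"
        using mvar_power [of "2 * i + 1" 2, where 'k = 'k] by (simp add: power2_eq_square)
      moreover have "mon ?c = (mvar (2 * i) * mvar (2 * i + 1) :: (nat, 'k) mpoly)"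
        by (simp add: mon_add mvar_def del: mconst_mult_single)
      ultimately show "mon (single (2 * i + 1) 2) - mon ?b \<in> K"
        by (simp add: algebra_simps)
    qed (simp_all add: mdeg_add weight_add)
  next
    case (adjacent i)
    have "1 \<le> lookup m (2 * i + 1)" using adjacent(2) by simp
    then obtain m1 where m1: "m = single (2 * i + 1) 1 + m1" "keys m1 \<subseteq> keys m"
        "\<forall>y. y \<noteq> 2 * i + 1 \<longrightarrow> lookup m1 y = lookup m y"
      by (rule split_off_power)
    have "1 \<le> lookup m1 (2 * i + 3)" using adjacent(3) m1(3) by simp
    then obtain m' where m': "m1 = single (2 * i + 3) 1 + m'" "keys m' \<subseteq> keys m1"
        "\<forall>y. y \<noteq> 2 * i + 3 \<longrightarrow> lookup m' y = lookup m1 y"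
      by (rule split_off_power)
    obtain f where f: "f \<in> edges G" "vertex_degrees G (single (2 * i + 1) 1 + single (2 * i + 3) 1) =
        vertex_degrees G (single (2 * i + 4) 1 + single f 1)"
      using adjacent_relation [OF adjacent(1)] by blast
    let ?b = "single (2 * i + 4) 1 + single f 1 :: nat \<Rightarrow>\<^sub>0 nat"
    let ?a = "single (2 * i + 1) 1 + single (2 * i + 3) 1 :: nat \<Rightarrow>\<^sub>0 nat"
    have iE: "2 * i + 1 \<in> edges G" "2 * i + 3 \<in> edges G" "2 * i + 4 \<in> edges G"
      using adjacent(1) by (auto simp: edges_eq)
    have b: "keys ?b \<subseteq> edges G" by (intro keys_subset_add E iE f)
    have a: "keys ?a \<subseteq> edges G" by (intro keys_subset_add E iE)
    show ?thesis
    proof (rule replace [of ?a m' ?b])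
      show "m = ?a + m'" by (simp only: m1(1) m'(1) add.assoc)
      show "mon ?a - mon ?b \<in> K"
        using toric_binomial [OF a b f(2)] K(2) by (rule rev_subsetD)
      show "keys m' \<subseteq> keys m" using m'(2) m1(2) by (rule order.trans)
      have "(3::nat) ^ (2 * i + 1) + 3 ^ (2 * i + 3) < 3 ^ (2 * i + 4)"
        by (simp add: power_add)
      then show "weight ?a < weight ?b" by (simp add: weight_add)
    qed (use b in \<open>simp_all add: mdeg_add\<close>)
  next
    case normal
    then obtain T where T: "T \<in> sparse_sets (n + 1)" "m = odd_mon T" by blast
    then have "mon m \<in> ?S (mdeg m)" by (simp add: mdeg_odd_mon)
    then show ?thesis by (intro mpoly.span_base) simp
  qed
qed

lemma carrier_subset_span_normal_forms:
  fixes K :: "(nat, 'k::field) mpoly set"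
  assumes K: "ideal K P" "toric_ideal G \<subseteq> K" "params_X TYPE('k) n \<subseteq> K"
  shows "carrier P \<subseteq> mpoly.span (K \<union> mon ` odd_mon ` sparse_sets (n + 1))"
  unfolding carrier_mpoly_ring
proof (rule mpoly.span_minimal [OF subsetI mpoly.subspace_span])
  fix s :: "(nat, 'k) mpoly" assume "s \<in> mon ` {m. keys m \<subseteq> edges G}"
  then obtain m where m: "s = mon m" "keys m \<subseteq> edges G" by blast
  have "K \<union> mon ` odd_mon ` {T \<in> sparse_sets (n + 1). card T = mdeg m} \<subseteq> K \<union> mon ` odd_mon ` sparse_sets (n + 1)"
    by (intro Un_mono order.refl image_mono) simp
  then have "mpoly.span (K \<union> mon ` odd_mon ` {T \<in> sparse_sets (n + 1). card T = mdeg m})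
      \<subseteq> mpoly.span (K \<union> mon ` odd_mon ` sparse_sets (n + 1))"
    by (rule mpoly.span_mono)
  then show "s \<in> mpoly.span (K \<union> mon ` odd_mon ` sparse_sets (n + 1))"
    using mon_mem_span_normal_forms [OF K m(2)] unfolding m(1) by (rule subsetD)
qed

text \<open>All ideals of the chain contain \<open>N 0\<close>, and the normal forms span modulo \<open>N 0\<close>. So for each
  inclusion a witness of strictness can be chosen in the span of the normal forms, and these
  witnesses are linearly independent.\<close>

theorem ideal_chain_length_le:
  fixes N :: "nat \<Rightarrow> (nat, 'k::field) mpoly set"
  assumes N: "ideal_chain P (toric_ideal G \<union> params_X TYPE('k) n) L N"
  shows "L \<le> fib (n + 3)"
proof -
  define B where "B = (mon ` odd_mon ` sparse_sets (n + 1) :: (nat, 'k) mpoly set)"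
  have N_ideal: "ideal (N i) P" "toric_ideal G \<subseteq> N i" "params_X TYPE('k) n \<subseteq> N i" if "i \<le> L" for i
    using N that by (simp_all add: ideal_chain_def)
  have N_less: "N i \<subset> N (Suc i)" if "i < L" for i
    using N that by (simp add: ideal_chain_def)
  have mono: "N 0 \<subseteq> N i" if "i \<le> L" for i
    using that
  proof (induction i)
    case (Suc i)
    then have "N 0 \<subseteq> N i" "N i \<subset> N (Suc i)" using N_less by simp_all
    then show ?case by simp
  qed simp
  have "\<exists>q. q \<in> N (Suc i) \<and> q \<notin> N i \<and> q \<in> mpoly.span B" if i: "i < L" for i
  proof -
    obtain p where p: "p \<in> N (Suc i)" "p \<notin> N i" using N_less [OF i] by (auto simp: psubset_eq)
    have "p \<in> carrier P" using ideal.Icarr [OF N_ideal(1) p(1)] i by simp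
    then have "p \<in> mpoly.span (N 0 \<union> B)"
      using carrier_subset_span_normal_forms [OF N_ideal, of 0] unfolding B_def by (simp add: subset_iff)
    then obtain x y where xy: "p = x + y" "x \<in> mpoly.span (N 0)" "y \<in> mpoly.span B"
      unfolding mpoly.span_Un by blast
    have "mpoly.span (N 0) \<subseteq> N 0"
      by (rule mpoly.span_minimal [OF order.refl subspace_ideal [OF N_ideal(1)]]) simp
    with xy(2) have "x \<in> N 0" by (rule rev_subsetD)
    then have x: "x \<in> N i" "x \<in> N (Suc i)" using mono i by (auto simp: subset_iff)
    have "y = p - x" using xy(1) by simp
    with p(1) x(2) have "y \<in> N (Suc i)"
      using mpoly.subspace_diff [OF subspace_ideal [OF N_ideal(1)]] i by simp
    moreover have "y \<notin> N i"
      using p(2) x(1) mpoly.subspace_add [OF subspace_ideal [OF N_ideal(1)], of i x y] i xy(1) by auto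
    ultimately show ?thesis using xy(3) by blast
  qed
  then obtain q where q: "\<And>i. i < L \<Longrightarrow> q i \<in> N (Suc i) \<and> q i \<notin> N i \<and> q i \<in> mpoly.span B"
    by metis
  have "mpoly.independent (q ` {..<l}) \<and> card (q ` {..<l}) = l \<and> mpoly.span (q ` {..<l}) \<subseteq> N l"
    if "l \<le> L" for l
    using that
  proof (induction l)
    case 0
    have "0 \<in> N 0" by (rule mpoly.subspace_0 [OF subspace_ideal [OF N_ideal(1)]]) simp
    then show ?case by (simp add: mpoly.independent_empty)
  next
    case (Suc l)
    then have IH: "mpoly.independent (q ` {..<l})" "card (q ` {..<l}) = l" "mpoly.span (q ` {..<l}) \<subseteq> N l"
      by simp_all
    have ql: "q l \<notin> mpoly.span (q ` {..<l})" using q [of l] IH(3) Suc.prems by (auto simp: subset_iff)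
    then have ql': "q l \<notin> q ` {..<l}" using mpoly.span_base by metis
    have "q ` {..<l} \<subseteq> N l" using IH(3) mpoly.span_superset by (rule order.trans [rotated])
    moreover have "N l \<subseteq> N (Suc l)" "q l \<in> N (Suc l)" using N_less [of l] q [of l] Suc.prems by simp_all
    ultimately have "insert (q l) (q ` {..<l}) \<subseteq> N (Suc l)" by simp
    then have "mpoly.span (insert (q l) (q ` {..<l})) \<subseteq> N (Suc l)"
      using subspace_ideal [OF N_ideal(1)] Suc.prems by (intro mpoly.span_minimal) simp_all
    moreover have "mpoly.independent (insert (q l) (q ` {..<l}))"
      by (rule mpoly.independent_insertI [OF ql IH(1)])
    moreover have "card (insert (q l) (q ` {..<l})) = Suc l" using ql' IH(2) by simp
    ultimately show ?case by (simp add: lessThan_Suc)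
  qed
  from this [of L] have "mpoly.independent (q ` {..<L})" "card (q ` {..<L}) = L" by simp_all
  moreover have "q ` {..<L} \<subseteq> mpoly.span B" using q by auto
  moreover have "finite B" by (simp add: B_def finite_sparse_sets)
  ultimately have "L \<le> card B" using mpoly.independent_span_bound [of B "q ` {..<L}"] by simp
  also have "card B \<le> card (sparse_sets (n + 1))"
    unfolding B_def by (intro order.trans [OF card_image_le] card_image_le finite_imageI finite_sparse_sets)
  also have "\<dots> = fib (n + 3)" by (simp add: card_sparse_sets numeral_3_eq_3)
  finally show ?thesis .
qed

section \<open>Hilbert functions and the lower bound\<close>

text \<open>The elements of \<^const>\<open>params_X\<close>, indexed by \<open>{..n + 2}\<close>: the variables \<open>x(0)\<close> and
  \<open>x(2n + 4)\<close> are numbers \<open>0\<close> and \<open>n + 2\<close>.\<close>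

definition linear_form :: "nat \<Rightarrow> (nat, 'k::field) mpoly" where
  "linear_form j = (if j = 0 then mvar 0 else if j = n + 2 then mvar (2 * n + 4)
    else mvar (2 * j) - mvar (2 * j + 1))"

lemma params_X_eq: "params_X TYPE('k::field) n = linear_form ` {..n + 2}"
proof -
  have atMost: "{..n + 2} = {0, n + 2} \<union> {1..n + 1}" by auto
  have ends: "linear_form 0 = mvar 0" "linear_form (n + 2) = mvar (2 * n + 4)"
    by (simp_all add: linear_form_def)
  have "(linear_form ` {1..n + 1} :: (nat, 'k) mpoly set) = {mvar (2 * i) - mvar (2 * i + 1) |i. i \<in> {1..n + 1}}"
    unfolding image_def by (auto simp: linear_form_def)
  then show ?thesis
    unfolding params_X_def atMost image_Un image_insert image_empty ends by simp
qed

lemma mvar_eq_mon: "mvar x = mon (single x 1)"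
  by (simp add: mvar_def)

lemma mvar_carrier: "x \<in> edges G \<Longrightarrow> mvar x \<in> carrier P"
  unfolding mvar_eq_mon by (rule mon_mem_mpoly_ring) simp

lemma linear_form_carrier: "j \<le> n + 2 \<Longrightarrow> linear_form j \<in> carrier P"
proof -
  assume j: "j \<le> n + 2"
  have ends: "0 \<in> edges G" "2 * n + 4 \<in> edges G" by (simp_all add: edges_eq)
  show ?thesis
  proof (cases "j = 0 \<or> j = n + 2")
    case True
    then show ?thesis using mvar_carrier ends by (auto simp: linear_form_def)
  next
    case False
    then have "2 * j \<in> edges G" "2 * j + 1 \<in> edges G" using j by (simp_all add: edges_eq)
    then have "mvar (2 * j) - mvar (2 * j + 1) \<in> carrier P"
      by (intro mpoly.subspace_diff [OF subspace_mpoly_ring] mvar_carrier)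
    then show ?thesis using False by (simp add: linear_form_def)
  qed
qed

lemma params_X_carrier: "params_X TYPE('k::field) n \<subseteq> carrier (P :: (nat, 'k) mpoly ring)"
  unfolding params_X_eq using linear_form_carrier by auto

text \<open>The homogeneous part of degree \<open>d\<close> of an element of the toric ring, computed in the
  polynomial ring on the vertices. The factor 2 appears because each edge has two ends.\<close>

definition degree_part :: "nat \<Rightarrow> ('v, 'k::field) mpoly \<Rightarrow> ('v, 'k) mpoly" where
  "degree_part d = lin_ext (\<lambda>w. if mdeg w = 2 * d then mon w else 0)"

lemma degree_part_mon:
  assumes "keys m \<subseteq> edges G"
  shows "degree_part d (mon (vertex_degrees G m)) = (if mdeg m = d then mon (vertex_degrees G m) else 0)"
  by (simp add: degree_part_def mdeg_vertex_degrees [OF assms])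

lemma degree_part_mult:
  assumes "keys m \<subseteq> edges G"
  shows "degree_part d (mon (vertex_degrees G m) * q)
    = (if mdeg m \<le> d then mon (vertex_degrees G m) * degree_part (d - mdeg m) q else 0)"
proof (cases "mdeg m \<le> d")
  case True
  have "degree_part d (mon (vertex_degrees G m) * q)
      = mon (vertex_degrees G m) * degree_part (d - mdeg m) q"
    unfolding degree_part_def
    by (rule lin_ext_mult_mon)
      (use True in \<open>auto simp: mdeg_add mdeg_vertex_degrees [OF assms] mult_single\<close>)
  with True show ?thesis by simp
next
  case False
  have "degree_part d (mon (vertex_degrees G m) * q) = 0 * lin_ext (\<lambda>_. 0) q"
    unfolding degree_part_def
    by (rule lin_ext_mult_mon)
      (use False in \<open>auto simp: mdeg_add mdeg_vertex_degrees [OF assms]\<close>)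
  with False show ?thesis by simp
qed

text \<open>The part of degree \<open>d\<close> of the ideal that the linear forms generate in the toric ring.\<close>

definition form_multiples :: "nat \<Rightarrow> ('v, 'k::field) mpoly set" where
  "form_multiples d = mpoly.span {toric_hom G (linear_form j * mon m) | j m.
    j \<le> n + 2 \<and> keys m \<subseteq> edges G \<and> mdeg m + 1 = d}"

lemma mon_mult_form_multiples:
  fixes q :: "('v, 'k::field) mpoly"
  assumes m: "keys m \<subseteq> edges G" and q: "q \<in> form_multiples d"
  shows "mon (vertex_degrees G m) * q \<in> form_multiples (mdeg m + d)"
  using q unfolding form_multiples_def
proof (rule span_mult_closed)
  fix s :: "('v, 'k) mpoly"
  assume "s \<in> {toric_hom G (linear_form j * mon m) | j m.
    j \<le> n + 2 \<and> keys m \<subseteq> edges G \<and> mdeg m + 1 = d}"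
  then obtain j m' where s: "s = toric_hom G (linear_form j * mon m')" "j \<le> n + 2"
      "keys m' \<subseteq> edges G" "mdeg m' + 1 = d"
    by blast
  have "mon (vertex_degrees G m) * s = toric_hom G (linear_form j * mon (m + m'))"
    unfolding s(1) toric_hom_mon [symmetric] toric_hom_mult [symmetric] mon_add
    by (simp add: mult.left_commute)
  moreover have "keys (m + m') \<subseteq> edges G" by (rule keys_subset_add [OF m s(3)])
  moreover have "mdeg (m + m') + 1 = mdeg m + d" using s(4) by (simp add: mdeg_add)
  ultimately show "mon (vertex_degrees G m) * s \<in> mpoly.span {toric_hom G (linear_form j * mon m') | j m'.
    j \<le> n + 2 \<and> keys m' \<subseteq> edges G \<and> mdeg m' + 1 = mdeg m + d}"
    using s(2) by (intro mpoly.span_base) blast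
qed

lemma subspace_form_multiples: "mpoly.subspace (form_multiples d)"
  unfolding form_multiples_def by (rule mpoly.subspace_span)

lemma degree_part_add: "degree_part d (p + q) = degree_part d p + degree_part d q"
  by (simp add: degree_part_def lin_ext_add)

lemma degree_part_scale: "degree_part d (mconst c * p) = mconst c * degree_part d p"
  by (simp add: degree_part_def lin_ext_scale)

lemma toric_hom_scale: "toric_hom G (mconst c * p) = mconst c * toric_hom G p"
  by (simp add: toric_hom_eq lin_ext_scale)

lemma toric_hom_minus: "toric_hom G (p - q) = toric_hom G p - toric_hom G q"
  by (simp add: toric_hom_eq lin_ext_minus)

lemma degree_part_mvar:
  assumes "x \<in> edges G"
  shows "degree_part d (toric_hom G (mvar x)) = (if d = 1 then toric_hom G (mvar x) else 0)"
proof -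
  have "keys (single x 1 :: nat \<Rightarrow>\<^sub>0 nat) \<subseteq> edges G" using assms by simp
  then show ?thesis
    unfolding mvar_eq_mon toric_hom_mon by (subst degree_part_mon) auto
qed

lemma degree_part_minus: "degree_part d (p - q) = degree_part d p - degree_part d q"
  by (simp add: degree_part_def lin_ext_minus)

lemma degree_part_linear_form:
  assumes "j \<le> n + 2"
  shows "degree_part d (toric_hom G (linear_form j)) = (if d = 1 then toric_hom G (linear_form j) else 0)"
proof -
  have "0 \<in> edges G" "2 * n + 4 \<in> edges G" by (simp_all add: edges_eq)
  moreover have "2 * j \<in> edges G" "2 * j + 1 \<in> edges G" if "j \<noteq> 0" "j \<noteq> n + 2"
    using that assms by (simp_all add: edges_eq)
  ultimately show ?thesis
    by (simp add: linear_form_def toric_hom_minus degree_part_minus degree_part_mvar del: One_nat_def)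
qed

text \<open>Both \<open>I\<close> and \<open>X\<close> are homogeneous. The polynomials with the claimed property form an ideal
  that contains them.\<close>

lemma degree_part_Idl:
  fixes p :: "(nat, 'k::field) mpoly"
  assumes "p \<in> Idl\<^bsub>P\<^esub> (toric_ideal G \<union> params_X TYPE('k) n)"
  shows "degree_part d (toric_hom G p) \<in> form_multiples d"
proof -
  define H where "H = {p \<in> carrier (P :: (nat, 'k) mpoly ring). \<forall>d. degree_part d (toric_hom G p) \<in> form_multiples d}"
  have "ideal H P"
  proof (rule ideal_mpoly_ringI)
    show "mpoly.subspace H"
    proof (rule mpoly.subspaceI)
      show "0 \<in> H"
        by (simp add: H_def toric_hom_eq degree_part_def mpoly.subspace_0 [OF subspace_mpoly_ring]
            mpoly.subspace_0 [OF subspace_form_multiples])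
      show "p + q \<in> H" if "p \<in> H" "q \<in> H" for p q
        using that by (simp add: H_def toric_hom_add degree_part_add
            mpoly.subspace_add [OF subspace_mpoly_ring] mpoly.subspace_add [OF subspace_form_multiples])
      show "mconst c * p \<in> H" if "p \<in> H" for c p
        using that by (simp add: H_def toric_hom_scale degree_part_scale
            mpoly.subspace_scale [OF subspace_mpoly_ring] mpoly.subspace_scale [OF subspace_form_multiples])
    qed
    show "H \<subseteq> carrier P" by (simp add: H_def)
    fix m :: "nat \<Rightarrow>\<^sub>0 nat" and p assume m: "keys m \<subseteq> edges G" and p: "p \<in> H"
    have "degree_part d (toric_hom G (mon m * p)) \<in> form_multiples d" for d
    proof (cases "mdeg m \<le> d")
      case True
      have "degree_part (d - mdeg m) (toric_hom G p) \<in> form_multiples (d - mdeg m)"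
        using p by (simp add: H_def)
      from mon_mult_form_multiples [OF m this] True show ?thesis
        by (simp add: toric_hom_mult toric_hom_mon degree_part_mult [OF m])
    next
      case False
      then show ?thesis
        by (simp add: toric_hom_mult toric_hom_mon degree_part_mult [OF m]
            mpoly.subspace_0 [OF subspace_form_multiples])
    qed
    moreover have "mon m * p \<in> carrier P"
      using p by (intro mult_mem_mpoly_ring mon_mem_mpoly_ring [OF m]) (simp add: H_def)
    ultimately show "mon m * p \<in> H" by (simp add: H_def)
  qed
  moreover have "toric_ideal G \<subseteq> H"
    by (auto simp: H_def mem_toric_ideal_iff degree_part_def mpoly.subspace_0 [OF subspace_form_multiples])
  moreover have "params_X TYPE('k) n \<subseteq> H"
    unfolding params_X_eq
  proof (rule image_subsetI)
    fix j assume j: "j \<in> {..n + 2}"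
    have "degree_part d (toric_hom G (linear_form j :: (nat, 'k) mpoly)) \<in> form_multiples d" for d
    proof (cases "d = 1")
      case True
      have "toric_hom G (linear_form j * mon 0 :: (nat, 'k) mpoly) \<in> form_multiples 1"
        unfolding form_multiples_def using j
        by (intro mpoly.span_base CollectI exI [of _ j] exI [of _ "0 :: nat \<Rightarrow>\<^sub>0 nat"]) simp
      then show ?thesis using True j by (simp add: degree_part_linear_form)
    next
      case False
      then show ?thesis
        using j by (simp add: degree_part_linear_form mpoly.subspace_0 [OF subspace_form_multiples])
    qed
    then show "(linear_form j :: (nat, 'k) mpoly) \<in> H"
      using j by (simp add: H_def linear_form_carrier)
  qed
  ultimately have "Idl\<^bsub>P\<^esub> (toric_ideal G \<union> params_X TYPE('k) n) \<subseteq> H"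
    by (intro ring.genideal_minimal [OF ring_mpoly_ring]) simp_all
  with assms have "p \<in> H" by (rule rev_subsetD)
  then show ?thesis by (simp add: H_def)
qed

text \<open>The exponents of the monomials of degree at most \<open>d\<close> in the \<open>n + 3\<close> linear forms.\<close>

definition exponents :: "nat \<Rightarrow> (nat \<Rightarrow> nat) set" where
  "exponents d = {\<alpha> \<in> {..n + 2} \<rightarrow>\<^sub>E UNIV. sum \<alpha> {..n + 2} \<le> d}"

definition form_power :: "(nat \<Rightarrow> nat) \<Rightarrow> (nat, 'k::field) mpoly" where
  "form_power \<alpha> = (\<Prod>j \<le> n + 2. linear_form j ^ \<alpha> j)"

lemma exponents_subset: "exponents d \<subseteq> {..n + 2} \<rightarrow>\<^sub>E {..d}"
proof
  fix \<alpha> assume \<alpha>: "\<alpha> \<in> exponents d"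
  have "\<alpha> j \<le> d" if "j \<in> {..n + 2}" for j
    using member_le_sum [of j "{..n + 2}" \<alpha>] that \<alpha> by (simp add: exponents_def)
  with \<alpha> show "\<alpha> \<in> {..n + 2} \<rightarrow>\<^sub>E {..d}"
    by (auto simp: exponents_def PiE_def)
qed

lemma finite_exponents: "finite (exponents d)"
  by (rule finite_subset [OF exponents_subset]) (auto intro: finite_PiE)

lemma card_exponents_le: "card (exponents d) \<le> (d + 1) ^ (n + 3)"
proof -
  have "card (exponents d) \<le> card ({..n + 2} \<rightarrow>\<^sub>E {..d})"
    by (rule card_mono [OF _ exponents_subset]) (auto intro: finite_PiE)
  also have "\<dots> = (d + 1) ^ (n + 3)" by (simp add: card_PiE numeral_3_eq_3)
  finally show ?thesis .
qed

lemma exponents_mono: "d \<le> d' \<Longrightarrow> exponents d \<subseteq> exponents d'"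
  by (auto simp: exponents_def)

lemma zero_exponents: "(\<lambda>j \<in> {..n + 2}. 0) \<in> exponents d"
  by (simp add: exponents_def)

lemma card_exponents_pos: "card (exponents d) > 0"
  using zero_exponents finite_exponents by (auto simp: card_gt_0_iff)

lemma form_power_zero: "form_power (\<lambda>j \<in> {..n + 2}. 0) = 1"
  by (simp add: form_power_def)

lemma form_power_Suc:
  assumes "\<alpha> \<in> exponents d" "j \<le> n + 2"
  shows "\<alpha>(j := Suc (\<alpha> j)) \<in> exponents (Suc d)"
    and "form_power (\<alpha>(j := Suc (\<alpha> j))) = linear_form j * (form_power \<alpha> :: (nat, 'k::field) mpoly)"
proof -
  have j: "j \<in> {..n + 2}" using assms(2) by simp
  have "sum (\<alpha>(j := Suc (\<alpha> j))) ({..n + 2} - {j}) = sum \<alpha> ({..n + 2} - {j})"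
    by (rule sum.cong) auto
  then have "sum (\<alpha>(j := Suc (\<alpha> j))) {..n + 2} = Suc (sum \<alpha> {..n + 2})"
    unfolding sum.remove [OF finite_atMost j, of \<alpha>]
      sum.remove [OF finite_atMost j, of "\<alpha>(j := Suc (\<alpha> j))"] by simp
  with assms show "\<alpha>(j := Suc (\<alpha> j)) \<in> exponents (Suc d)"
    by (auto simp: exponents_def PiE_def extensional_def)
  have "(\<Prod>i \<in> {..n + 2} - {j}. linear_form i ^ (\<alpha>(j := Suc (\<alpha> j))) i)
      = (\<Prod>i \<in> {..n + 2} - {j}. linear_form i ^ \<alpha> i :: (nat, 'k) mpoly)"
    by (rule prod.cong) auto
  then show "form_power (\<alpha>(j := Suc (\<alpha> j))) = linear_form j * (form_power \<alpha> :: (nat, 'k) mpoly)"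
    unfolding form_power_def prod.remove [OF finite_atMost j] by (simp add: mult.assoc)
qed

definition form_span :: "(nat \<Rightarrow>\<^sub>0 nat) set \<Rightarrow> nat \<Rightarrow> ('v, 'k::field) mpoly set" where
  "form_span B d = (\<lambda>(\<alpha>, b). toric_hom G (form_power \<alpha> * mon b)) ` (exponents d \<times> B)"

lemma form_span_mono: "d \<le> d' \<Longrightarrow> mpoly.span (form_span B d) \<subseteq> mpoly.span (form_span B d')"
  unfolding form_span_def by (intro mpoly.span_mono image_mono Sigma_mono exponents_mono) auto

lemma linear_form_mult_form_span:
  fixes p :: "('v, 'k::field) mpoly"
  assumes "j \<le> n + 2" "p \<in> mpoly.span (form_span B d)"
  shows "toric_hom G (linear_form j) * p \<in> mpoly.span (form_span B (Suc d))"
  using assms(2)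
proof (rule span_mult_closed)
  fix s :: "('v, 'k) mpoly" assume "s \<in> form_span B d"
  then obtain \<alpha> b where s: "s = toric_hom G (form_power \<alpha> * mon b)" "\<alpha> \<in> exponents d" "b \<in> B"
    by (auto simp: form_span_def)
  have "toric_hom G (linear_form j) * s = toric_hom G (form_power (\<alpha>(j := Suc (\<alpha> j))) * mon b)"
    unfolding s(1) toric_hom_mult [symmetric] form_power_Suc(2) [OF s(2) assms(1)]
    by (simp only: mult.assoc)
  then show "toric_hom G (linear_form j) * s \<in> mpoly.span (form_span B (Suc d))"
    using form_power_Suc(1) [OF s(2) assms(1)] s(3)
    by (intro mpoly.span_base) (force simp: form_span_def)
qed

text \<open>In degree \<open>d\<close>, the element is a combination of elements of \<open>B\<close> plus multiples of the linear
  forms by elements of degree \<open>d - 1\<close>, to which induction applies.\<close>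

lemma graded_Nakayama:
  fixes B :: "(nat \<Rightarrow>\<^sub>0 nat) set"
  assumes B: "\<And>b. b \<in> B \<Longrightarrow> keys b \<subseteq> edges G"
    and span: "\<And>m. keys m \<subseteq> edges G \<Longrightarrow>
      mon m \<in> mpoly.span (Idl\<^bsub>P\<^esub> (toric_ideal G \<union> params_X TYPE('k) n) \<union> (mon ` B :: (nat, 'k::field) mpoly set))"
    and m: "keys m \<subseteq> edges G"
  shows "mon (vertex_degrees G m) \<in> mpoly.span (form_span B (mdeg m) :: ('v, 'k) mpoly set)"
  using m
proof (induction "mdeg m" arbitrary: m rule: less_induct)
  case less
  let ?d = "mdeg m"
  let ?S = "mpoly.span (form_span B ?d) :: ('v, 'k) mpoly set"
  define h :: "(nat, 'k) mpoly \<Rightarrow> ('v, 'k) mpoly" where "h p = degree_part ?d (toric_hom G p)" for p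
  have "form_multiples ?d \<subseteq> ?S"
    unfolding form_multiples_def
  proof (rule mpoly.span_minimal [OF subsetI mpoly.subspace_span])
    fix s :: "('v, 'k) mpoly"
    assume "s \<in> {toric_hom G (linear_form j * mon m) | j m.
      j \<le> n + 2 \<and> keys m \<subseteq> edges G \<and> mdeg m + 1 = ?d}"
    then obtain j m' where s: "s = toric_hom G (linear_form j * mon m')" "j \<le> n + 2"
        "keys m' \<subseteq> edges G" "Suc (mdeg m') = ?d"
      by auto
    have "mon (vertex_degrees G m') \<in> mpoly.span (form_span B (mdeg m') :: ('v, 'k) mpoly set)"
      using s(3,4) by (intro less.hyps) auto
    from linear_form_mult_form_span [OF s(2) this]
    show "s \<in> ?S" unfolding s(1,4) toric_hom_mult toric_hom_mon .
  qed
  then have Idl: "h p \<in> ?S" if "p \<in> Idl\<^bsub>P\<^esub> (toric_ideal G \<union> params_X TYPE('k) n)" for p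
    unfolding h_def using degree_part_Idl [OF that] by (rule subsetD)
  have base: "h (mon b) \<in> ?S" if b: "b \<in> B" for b
  proof (cases "mdeg b = ?d")
    case True
    have "toric_hom G (form_power (\<lambda>j \<in> {..n + 2}. 0) * mon b :: (nat, 'k) mpoly) \<in> form_span B ?d"
      unfolding form_span_def using zero_exponents b by force
    then have "mon (vertex_degrees G b) \<in> (form_span B ?d :: ('v, 'k) mpoly set)"
      unfolding form_power_zero toric_hom_mon mult_1 .
    with True show ?thesis
      unfolding h_def toric_hom_mon degree_part_mon [OF B [OF b]] by (simp add: mpoly.span_base)
  next
    case False
    then show ?thesis
      unfolding h_def toric_hom_mon degree_part_mon [OF B [OF b]] by (simp add: mpoly.span_zero)
  qed
  have "h (mon m) \<in> ?S"
    using span [OF less.prems]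
  proof (induction rule: mpoly.span_induct_alt)
    case base
    show ?case by (simp add: h_def toric_hom_eq degree_part_def mpoly.span_zero)
  next
    case (step c x y)
    have "h (mconst c * x + y) = mconst c * h x + h y"
      unfolding h_def toric_hom_add toric_hom_scale degree_part_add degree_part_scale ..
    moreover have "h x \<in> ?S" using step.hyps Idl base by auto
    ultimately show ?case using step.IH by (simp add: mpoly.span_add mpoly.span_scale)
  qed
  then show ?case unfolding h_def toric_hom_mon degree_part_mon [OF less.prems] by simp
qed

text \<open>The \<open>n + 3\<close> variables that belong to \<open>T\<close>, enumerated so that \<open>x(2j)\<close> and \<open>x(2j + 1)\<close> have
  number \<open>j\<close>. These sets of variables are the facets of the simplicial complex of supports of standard
  monomials.\<close>

definition facet_edge :: "nat set \<Rightarrow> nat \<Rightarrow> nat" where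
  "facet_edge T j = (if j = 0 then 0 else if j = n + 2 then 2 * n + 4
    else if j \<in> T then 2 * j + 1 else 2 * j)"

text \<open>The successor makes all \<open>n + 3\<close> variables occur, so that \<open>T\<close> can be recovered.\<close>

definition facet_mon :: "nat set \<Rightarrow> (nat \<Rightarrow> nat) \<Rightarrow> (nat \<Rightarrow>\<^sub>0 nat)" where
  "facet_mon T \<alpha> = (\<Sum>j \<le> n + 2. single (facet_edge T j) (Suc (\<alpha> j)))"

lemma facet_edge_div: "j \<le> n + 2 \<Longrightarrow> facet_edge T j div 2 = j"
  by (simp add: facet_edge_def)

lemma lookup_facet_mon:
  assumes "x div 2 \<le> n + 2"
  shows "lookup (facet_mon T \<alpha>) x
    = (if facet_edge T (x div 2) = x then Suc (\<alpha> (x div 2)) else 0)"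
proof -
  have "lookup (facet_mon T \<alpha>) x
      = (\<Sum>j \<le> n + 2. if j = x div 2 then (if facet_edge T j = x then Suc (\<alpha> j) else 0) else 0)"
    unfolding facet_mon_def lookup_sum lookup_single
    by (rule sum.cong) (auto simp: when_def facet_edge_div)
  also have "\<dots> = (if facet_edge T (x div 2) = x then Suc (\<alpha> (x div 2)) else 0)"
    using assms by (simp add: sum.delta)
  finally show ?thesis .
qed

lemma keys_facet_mon: "keys (facet_mon T \<alpha>) \<subseteq> edges G"
proof -
  have "facet_edge T j \<in> edges G" if "j \<le> n + 2" for j
  proof -
    have "j = 0 \<or> j = n + 2 \<or> (1 \<le> j \<and> j \<le> n + 1)" using that by linarith
    then show ?thesis by (auto simp: facet_edge_def edges_eq)
  qed
  then show ?thesis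
    unfolding facet_mon_def by (intro order.trans [OF keys_sum_subset]) auto
qed

lemma mdeg_facet_mon: "mdeg (facet_mon T \<alpha>) = sum \<alpha> {..n + 2} + (n + 3)"
  by (simp add: facet_mon_def mdeg_sum sum.distrib sum_Suc del: sum.atMost_Suc)

lemma standard_facet_mon:
  assumes T: "T \<in> sparse_sets (n + 1)"
  shows "standard (facet_mon T \<alpha>)"
  unfolding standard_def
proof (intro conjI ballI keys_facet_mon)
  fix i assume "i \<in> {1..n + 1}"
  then show "lookup (facet_mon T \<alpha>) (2 * i) = 0 \<or> lookup (facet_mon T \<alpha>) (2 * i + 1) = 0"
    by (simp add: lookup_facet_mon facet_edge_def)
next
  fix i assume i: "i \<in> {1..n}"
  have "(2 * i + 3) div 2 = Suc i" by simp
  moreover have "Suc i \<notin> T" if "i \<in> T" using T that by (auto simp: sparse_sets_def)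
  ultimately show "lookup (facet_mon T \<alpha>) (2 * i + 1) = 0 \<or> lookup (facet_mon T \<alpha>) (2 * i + 3) = 0"
    using i by (auto simp: lookup_facet_mon facet_edge_def)
qed

lemma facet_mon_inj:
  assumes T: "T \<in> sparse_sets (n + 1)" "T' \<in> sparse_sets (n + 1)"
    and \<alpha>: "\<alpha> \<in> exponents d" "\<alpha>' \<in> exponents d" and eq: "facet_mon T \<alpha> = facet_mon T' \<alpha>'"
  shows "T = T' \<and> \<alpha> = \<alpha>'"
proof
  have mem: "i \<in> S \<longleftrightarrow> i \<in> {1..n + 1} \<and> lookup (facet_mon S \<beta>) (2 * i + 1) \<noteq> 0"
    if S: "S \<in> sparse_sets (n + 1)" for S \<beta> i
  proof (cases "i \<in> {1..n + 1}")
    case True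
    then show ?thesis by (simp add: lookup_facet_mon facet_edge_def)
  next
    case False
    then show ?thesis using S by (auto simp: sparse_sets_def)
  qed
  show "T = T'"
    by (rule Set.set_eqI) (simp only: mem [OF T(1), of _ \<alpha>] mem [OF T(2), of _ \<alpha>'] eq)
  show "\<alpha> = \<alpha>'"
  proof (rule PiE_ext [of \<alpha> "{..n + 2}" "\<lambda>_. UNIV" \<alpha>'])
    fix j assume j: "j \<in> {..n + 2}"
    then have "facet_edge T j div 2 = j" by (simp add: facet_edge_div)
    moreover have "lookup (facet_mon T \<alpha>) (facet_edge T j) = lookup (facet_mon T \<alpha>') (facet_edge T j)"
      using eq \<open>T = T'\<close> by simp
    ultimately show "\<alpha> j = \<alpha>' j" using j by (simp add: lookup_facet_mon)
  qed (use \<alpha> in \<open>simp_all add: exponents_def\<close>)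
qed

text \<open>The comparison of Hilbert functions: the monomials supported on the facets are independent in
  the toric ring, while the products of powers of the linear forms with elements of \<open>B\<close> span it.\<close>

lemma card_spanning_ge:
  fixes B :: "(nat \<Rightarrow>\<^sub>0 nat) set"
  assumes B: "finite B" "\<And>b. b \<in> B \<Longrightarrow> keys b \<subseteq> edges G"
    and span: "\<And>m. keys m \<subseteq> edges G \<Longrightarrow>
      mon m \<in> mpoly.span (Idl\<^bsub>P\<^esub> (toric_ideal G \<union> params_X TYPE('k) n) \<union> (mon ` B :: (nat, 'k::field) mpoly set))"
  shows "fib (n + 3) \<le> card B"
proof (rule growth_comparison [where c = "n + 3" and N = "\<lambda>d. card (exponents d)"])
  fix d
  let ?F = "(\<lambda>(T, \<alpha>). facet_mon T \<alpha>) ` (sparse_sets (n + 1) \<times> exponents d)"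
  let ?M = "mon ` vertex_degrees G ` ?F :: ('v, 'k) mpoly set"
  have "inj_on (\<lambda>(T, \<alpha>). facet_mon T \<alpha>) (sparse_sets (n + 1) \<times> exponents d)"
    using facet_mon_inj by (auto simp: inj_on_def)
  then have "card ?F = card (sparse_sets (n + 1)) * card (exponents d)"
    by (simp add: card_image card_cartesian_product)
  moreover have "inj_on (vertex_degrees G) ?F"
    by (rule inj_onI, rule standard_eqI) (auto intro: standard_facet_mon)
  ultimately have card: "card ?M = fib (n + 3) * card (exponents d)"
    by (simp add: card_image inj_mon card_sparse_sets numeral_3_eq_3)
  have "?M \<subseteq> mpoly.span (form_span B (d + (n + 3)))"
  proof (rule subsetI)
    fix s assume "s \<in> ?M"
    then obtain T \<alpha> where s: "s = mon (vertex_degrees G (facet_mon T \<alpha>))" and \<alpha>: "\<alpha> \<in> exponents d"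
      by auto
    have "mdeg (facet_mon T \<alpha>) \<le> d + (n + 3)"
      using \<alpha> by (simp add: mdeg_facet_mon exponents_def del: sum.atMost_Suc)
    then have "mpoly.span (form_span B (mdeg (facet_mon T \<alpha>))) \<subseteq> mpoly.span (form_span B (d + (n + 3)) :: ('v, 'k) mpoly set)"
      by (rule form_span_mono)
    then show "s \<in> mpoly.span (form_span B (d + (n + 3)))"
      unfolding s using graded_Nakayama [OF B(2) span keys_facet_mon] by (rule subsetD)
  qed
  moreover have "finite (form_span B (d + (n + 3)) :: ('v, 'k) mpoly set)"
    unfolding form_span_def by (intro finite_imageI finite_cartesian_product finite_exponents B(1))
  ultimately have "card ?M \<le> card (form_span B (d + (n + 3)) :: ('v, 'k) mpoly set)"
    using mpoly.independent_span_bound [OF _ independent_mon] by blast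
  also have "\<dots> \<le> card (exponents (d + (n + 3)) \<times> B)"
    unfolding form_span_def by (intro card_image_le finite_cartesian_product finite_exponents B(1))
  finally show "fib (n + 3) * card (exponents d) \<le> card B * card (exponents (d + (n + 3)))"
    unfolding card card_cartesian_product by (simp only: mult.commute)
qed (use card_exponents_pos card_exponents_le in simp_all)

section \<open>A maximal chain of ideals\<close>

text \<open>The normal forms are added to \<open>J\<close> one at a time, those of larger degree first. Multiplying
  one of them by a nonconstant monomial raises the degree, and the product is a combination, modulo
  \<open>J\<close>, of normal forms that were added earlier; so every step yields an ideal. A step without
  effect would leave a spanning set with fewer than \<open>F(n + 3)\<close> elements.\<close>

lemma ideal_chain_exists:
  "\<exists>N. ideal_chain P (toric_ideal G \<union> params_X TYPE('k::field) n) (fib (n + 3)) N"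
proof -
  define J where "J = Idl\<^bsub>P\<^esub> (toric_ideal G \<union> params_X TYPE('k) n)"
  have sub: "toric_ideal G \<union> params_X TYPE('k) n \<subseteq> carrier (P :: (nat, 'k) mpoly ring)"
    using params_X_carrier by (auto simp: mem_toric_ideal_iff)
  have J: "ideal J P"
    unfolding J_def by (rule ring.genideal_ideal [OF ring_mpoly_ring sub])
  have J_sup: "toric_ideal G \<subseteq> J" "params_X TYPE('k) n \<subseteq> J"
    unfolding J_def using ring.genideal_self [OF ring_mpoly_ring sub] by simp_all
  obtain ys where ys: "set ys = sparse_sets (n + 1)" "distinct ys"
    using finite_distinct_list [OF finite_sparse_sets] by blast
  define xs where "xs = rev (sort_key card ys)"
  have xs: "set xs = sparse_sets (n + 1)" "distinct xs" using ys by (simp_all add: xs_def)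
  have len: "length xs = fib (n + 3)"
    using distinct_card [OF xs(2)] by (simp add: xs(1) card_sparse_sets numeral_3_eq_3)
  have decreasing: "card (xs ! j) \<le> card (xs ! i)" if "i \<le> j" "j < length xs" for i j
  proof -
    have "sorted (rev (map card xs))" by (simp add: xs_def rev_map)
    from sorted_rev_nth_mono [OF this] that show ?thesis by simp
  qed
  define S where "S i = J \<union> mon ` odd_mon ` (!) xs ` {..<i}" for i
  have in_sparse: "xs ! l \<in> sparse_sets (n + 1)" if "l < length xs" for l
    using that xs(1) nth_mem by blast
  have K_ideal: "ideal (mpoly.span (S i)) P" if i: "i \<le> length xs" for i
  proof (rule ideal_mpoly_ringI [OF _ mpoly.subspace_span])
    have "mon (odd_mon (xs ! l)) \<in> carrier P" if "l < i" for l
      using that i by (intro mon_mem_mpoly_ring keys_odd_mon in_sparse) simp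
    then have "S i \<subseteq> carrier P"
      using ideal.Icarr [OF J] by (auto simp: S_def)
    then show "mpoly.span (S i) \<subseteq> carrier P"
      by (rule mpoly.span_minimal [OF _ subspace_mpoly_ring])
    fix m :: "nat \<Rightarrow>\<^sub>0 nat" and p assume m: "keys m \<subseteq> edges G" and "p \<in> mpoly.span (S i)"
    from this(2) show "mon m * p \<in> mpoly.span (S i)"
    proof (rule span_mult_closed)
      fix s assume "s \<in> S i"
      then consider "s \<in> J" | l where "l < i" "s = mon (odd_mon (xs ! l))"
        unfolding S_def by blast
      then show "mon m * s \<in> mpoly.span (S i)"
      proof cases
        case 1
        have "mon m * s \<in> J"
          using ideal.I_l_closed [OF J 1 mon_mem_mpoly_ring [OF m]] by simp
        then show ?thesis by (intro mpoly.span_base) (simp add: S_def)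
      next
        case (2 l)
        show ?thesis
        proof (cases "m = 0")
          case True
          then show ?thesis using \<open>s \<in> S i\<close> by (simp add: mpoly.span_base)
        next
          case False
          define p where "p = m + odd_mon (xs ! l)"
          have l: "l < length xs" using 2(1) i by simp
          have "card (xs ! l) < mdeg p"
          proof -
            have "mdeg m \<noteq> 0" using False by (simp add: mdeg_eq_0_iff)
            then show ?thesis by (simp add: p_def mdeg_add mdeg_odd_mon)
          qed
          have "{T \<in> sparse_sets (n + 1). card T = mdeg p} \<subseteq> (!) xs ` {..<i}"
          proof
            fix T assume T: "T \<in> {T \<in> sparse_sets (n + 1). card T = mdeg p}"
            then have "T \<in> set xs" unfolding xs(1) by simp
            then obtain l' where l': "l' < length xs" "T = xs ! l'"
              unfolding in_set_conv_nth by blast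
            have "l' < l"
            proof (rule ccontr)
              assume "\<not> l' < l"
              then have "card T \<le> card (xs ! l)" unfolding l'(2) using decreasing l'(1) by simp
              then show False using T \<open>card (xs ! l) < mdeg p\<close> by simp
            qed
            then show "T \<in> (!) xs ` {..<i}" using l'(2) 2(1) by auto
          qed
          then have "J \<union> mon ` odd_mon ` {T \<in> sparse_sets (n + 1). card T = mdeg p} \<subseteq> S i"
            unfolding S_def by (intro Un_mono order.refl image_mono)
          then have "mpoly.span (J \<union> mon ` odd_mon ` {T \<in> sparse_sets (n + 1). card T = mdeg p}) \<subseteq> mpoly.span (S i)"
            by (rule mpoly.span_mono)
          moreover have "keys p \<subseteq> edges G"
            unfolding p_def by (rule keys_subset_add [OF m keys_odd_mon [OF in_sparse [OF l]]])
          then have "mon p \<in> mpoly.span (J \<union> mon ` odd_mon ` {T \<in> sparse_sets (n + 1). card T = mdeg p})"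
            by (rule mon_mem_span_normal_forms [OF J J_sup])
          ultimately have "mon p \<in> mpoly.span (S i)" by (rule subsetD)
          then show ?thesis unfolding p_def mon_add 2(2) .
        qed
      qed
    qed
  qed
  have new: "mon (odd_mon (xs ! i)) \<notin> mpoly.span (S i)" if i: "i < length xs" for i
  proof
    assume mem: "mon (odd_mon (xs ! i)) \<in> mpoly.span (S i)"
    define R where "R = sparse_sets (n + 1) - {xs ! i}"
    let ?B = "odd_mon ` R"
    have "(!) xs ` {..<i} \<subseteq> R"
    proof (rule image_subsetI)
      fix l assume "l \<in> {..<i}"
      then have "l < length xs" "l \<noteq> i" using i by simp_all
      then show "xs ! l \<in> R" unfolding R_def using in_sparse i by (simp add: nth_eq_iff_index_eq [OF xs(2)])
    qed
    then have "S i \<subseteq> J \<union> mon ` ?B"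
      unfolding S_def by (intro Un_mono order.refl image_mono)
    then have "mpoly.span (S i) \<subseteq> mpoly.span (J \<union> mon ` ?B)" by (rule mpoly.span_mono)
    with mem have i_mem: "mon (odd_mon (xs ! i)) \<in> mpoly.span (J \<union> mon ` ?B)" by (rule rev_subsetD)
    have "J \<union> mon ` odd_mon ` sparse_sets (n + 1) \<subseteq> mpoly.span (J \<union> mon ` ?B)"
    proof
      fix s assume "s \<in> J \<union> mon ` odd_mon ` sparse_sets (n + 1)"
      then have "s \<in> J \<union> mon ` ?B \<or> s = mon (odd_mon (xs ! i))" by (auto simp: R_def)
      then show "s \<in> mpoly.span (J \<union> mon ` ?B)" using i_mem by (auto simp: mpoly.span_base)
    qed
    then have "mpoly.span (J \<union> mon ` odd_mon ` sparse_sets (n + 1)) \<subseteq> mpoly.span (J \<union> mon ` ?B)"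
      by (rule mpoly.span_minimal [OF _ mpoly.subspace_span])
    with carrier_subset_span_normal_forms [OF J J_sup]
    have carr: "carrier P \<subseteq> mpoly.span (J \<union> mon ` ?B)" by (rule order.trans)
    have "fib (n + 3) \<le> card ?B"
    proof (rule card_spanning_ge [where 'k = 'k])
      show "finite ?B" by (simp add: R_def finite_sparse_sets)
      show "keys b \<subseteq> edges G" if "b \<in> ?B" for b
        using that keys_odd_mon by (auto simp: R_def)
      show "mon m \<in> mpoly.span (Idl\<^bsub>P\<^esub> (toric_ideal G \<union> params_X TYPE('k) n) \<union> mon ` ?B)"
        if "keys m \<subseteq> edges G" for m
        using carr mon_mem_mpoly_ring [OF that] unfolding J_def by (rule subsetD)
    qed
    also have "card ?B \<le> card R" by (rule card_image_le) (simp add: R_def finite_sparse_sets)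
    also have "card R < card (sparse_sets (n + 1))"
      unfolding R_def by (rule card_Diff1_less [OF finite_sparse_sets in_sparse [OF i]])
    finally show False by (simp add: card_sparse_sets numeral_3_eq_3)
  qed
  have "mpoly.span (S i) \<subset> mpoly.span (S (Suc i))" if i: "i < length xs" for i
  proof
    have "S i \<subseteq> S (Suc i)" unfolding S_def by (intro Un_mono order.refl image_mono) simp
    then show "mpoly.span (S i) \<subseteq> mpoly.span (S (Suc i))" by (rule mpoly.span_mono)
    have "mon (odd_mon (xs ! i)) \<in> S (Suc i)" unfolding S_def by simp
    then have "mon (odd_mon (xs ! i)) \<in> mpoly.span (S (Suc i))" by (rule mpoly.span_base)
    then show "mpoly.span (S i) \<noteq> mpoly.span (S (Suc i))" using new [OF i] by auto
  qed
  moreover have "toric_ideal G \<union> params_X TYPE('k) n \<subseteq> mpoly.span (S i)" for i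
  proof -
    have "J \<subseteq> mpoly.span (S i)"
      by (rule order.trans [OF _ mpoly.span_superset]) (simp add: S_def)
    with J_sup show ?thesis by blast
  qed
  ultimately have "ideal_chain P (toric_ideal G \<union> params_X TYPE('k) n) (length xs) (\<lambda>i. mpoly.span (S i))"
    using K_ideal by (simp add: ideal_chain_def)
  then show ?thesis unfolding len by blast
qed

theorem ring_length_eq_fib:
  defines "R \<equiv> (P :: (nat, 'k::field) mpoly ring) Quot toric_ideal G"
  shows "ring_length (R Quot Idl\<^bsub>R\<^esub> ((+>\<^bsub>P\<^esub>) (toric_ideal G) ` params_X TYPE('k) n)) = enat (fib (n + 3))"
proof -
  have "(SUP L \<in> {L. \<exists>N. ideal_chain P (toric_ideal G \<union> params_X TYPE('k) n) L N}. enat L) = enat (fib (n + 3))"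
  proof (rule antisym)
    show "(SUP L \<in> {L. \<exists>N. ideal_chain P (toric_ideal G \<union> params_X TYPE('k) n) L N}. enat L) \<le> enat (fib (n + 3))"
      by (rule SUP_least) (auto dest: ideal_chain_length_le)
    show "enat (fib (n + 3)) \<le> (SUP L \<in> {L. \<exists>N. ideal_chain P (toric_ideal G \<union> params_X TYPE('k) n) L N}. enat L)"
      by (rule SUP_upper) (simp add: ideal_chain_exists)
  qed
  then show ?thesis
    unfolding R_def
    by (subst ring_length_iterated_quotient [OF cring_mpoly_ring ideal_toric_ideal params_X_carrier])
      (simp_all add: ends_subset)
qed

end

section \<open>The arrays\<close>

definition incident :: "(nat \<times> nat \<rightharpoonup> nat) \<Rightarrow> vertex \<Rightarrow> nat set" where
  "incident A v = (case v of Row r \<Rightarrow> {j. \<exists>c. A (r, c) = Some j} | Col c \<Rightarrow> {j. \<exists>r. A (r, c) = Some j})"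

lemma mem_incident [simp]:
  "j \<in> incident A (Row r) \<longleftrightarrow> (\<exists>c. A (r, c) = Some j)"
  "j \<in> incident A (Col c) \<longleftrightarrow> (\<exists>r. A (r, c) = Some j)"
  by (simp_all add: incident_def)

text \<open>The entries \<open>a\<close> and \<open>b\<close> are opposite corners of a completely filled \<open>2 \<times> 2\<close> minor, and \<open>d\<close> is
  one of the other two corners. In the graph this is a 4-cycle. The disjunction makes the notion
  invariant under transposition.\<close>

definition on_minor :: "(nat \<times> nat \<rightharpoonup> nat) \<Rightarrow> nat \<Rightarrow> nat \<Rightarrow> nat \<Rightarrow> bool" where
  "on_minor A a b d \<longleftrightarrow> (\<exists>p q p' q' f. A (p, q) = Some a \<and> A (p', q') = Some b \<and>
    (A (p, q') = Some d \<and> A (p', q) = Some f \<or> A (p, q') = Some f \<and> A (p', q) = Some d))"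

definition separated :: "(nat \<times> nat \<rightharpoonup> nat) \<Rightarrow> nat \<Rightarrow> bool" where
  "separated A i \<longleftrightarrow> (\<exists>a b. \<forall>e \<in> ran A. e \<le> 2 * i + 4 \<longrightarrow>
    (e \<in> incident A a \<longleftrightarrow> e \<in> {2 * i + 3, 2 * i + 4}) \<and>
    (e \<in> incident A b \<longleftrightarrow> e \<in> {2 * i + 1, 2 * i + 2, 2 * i + 4}))"

definition ladder_like :: "(nat \<times> nat \<rightharpoonup> nat) \<Rightarrow> nat \<Rightarrow> bool" where
  "ladder_like A n \<longleftrightarrow> ran A = {0} \<union> {2..2 * n + 4} \<and> inj_on A (dom A) \<and>
    dom A \<subseteq> {1..nrows n} \<times> {1..ncols n} \<and>
    (\<forall>i \<in> {1..n + 1}. on_minor A (2 * i) (2 * i + 1) (2 * i + 2)) \<and>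
    (\<forall>i \<in> {1..n}. on_minor A (2 * i + 1) (2 * i + 3) (2 * i + 4)) \<and>
    (\<forall>i \<le> n. separated A i)"

lemma ladder_like_imp_ladder_toric:
  assumes "ladder_like (ladder_array n t) n"
  shows "ladder_toric n (ladder_graph n t)"
proof -
  define A where "A = ladder_array n t"
  let ?G = "ladder_graph n t"
  have A: "ran A = {0} \<union> {2..2 * n + 4}" "inj_on A (dom A)" "dom A \<subseteq> {1..nrows n} \<times> {1..ncols n}"
      "\<And>i. i \<in> {1..n + 1} \<Longrightarrow> on_minor A (2 * i) (2 * i + 1) (2 * i + 2)"
      "\<And>i. i \<in> {1..n} \<Longrightarrow> on_minor A (2 * i + 1) (2 * i + 3) (2 * i + 4)"
      "\<And>i. i \<le> n \<Longrightarrow> separated A i"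
    using assms by (simp_all add: ladder_like_def A_def)
  have edges: "edges ?G = ran A" by (simp add: ladder_graph_def A_def)
  have ends: "ends ?G e = {Row r, Col c}" if "A (r, c) = Some e" for r c e
  proof -
    have "(r', c') = (r, c)" if "A (r', c') = Some e" for r' c'
      using that \<open>A (r, c) = Some e\<close> by (intro inj_onD [OF A(2)]) auto
    with that have "{{Row r, Col c} | r c. A (r, c) = Some e} = {{Row r, Col c}}" by blast
    then show ?thesis by (simp add: ladder_graph_def A_def)
  qed
  have ex: "\<exists>r c. A (r, c) = Some e" if "e \<in> edges ?G" for e
    using that unfolding edges by (auto simp: ran_def)
  have minor: "\<exists>f \<in> edges ?G. vertex_degrees ?G (single a 1 + single b 1)
      = vertex_degrees ?G (single d 1 + single f 1)" if m: "on_minor A a b d" for a b d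
  proof -
    obtain p q p' q' f where f: "A (p, q) = Some a" "A (p', q') = Some b"
        "A (p, q') = Some d \<and> A (p', q) = Some f \<or> A (p, q') = Some f \<and> A (p', q) = Some d"
      using m unfolding on_minor_def by blast
    have "f \<in> edges ?G" unfolding edges using f(3) by (auto intro: ranI)
    moreover have "vertex_degrees ?G (single a 1 + single b 1)
        = vertex_degrees ?G (single d 1 + single f 1)"
      using f(3) by (auto simp: vertex_degrees_add vertex_degrees_single ends [OF f(1)] ends [OF f(2)] ends add_ac)
    ultimately show ?thesis by blast
  qed
  have incident: "v \<in> ends ?G e \<longleftrightarrow> e \<in> incident A v" if e: "e \<in> edges ?G" for v e
  proof -
    obtain r c where rc: "A (r, c) = Some e" using ex [OF e] by blast
    have "A (r', c') = Some e \<longleftrightarrow> r' = r \<and> c' = c" for r' c'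
    proof
      assume "A (r', c') = Some e"
      then show "r' = r \<and> c' = c"
        using rc inj_onD [OF A(2), of "(r', c')" "(r, c)"] by (simp add: domIff)
    qed (simp add: rc)
    then show ?thesis
      unfolding ends [OF rc] by (cases v) simp_all
  qed
  show ?thesis
  proof
    show "edges ?G = {0} \<union> {2..2 * n + 4}" by (simp only: edges A(1))
    show "ends ?G e \<subseteq> verts ?G" if e: "e \<in> edges ?G" for e
    proof -
      obtain r c where rc: "A (r, c) = Some e" using ex [OF e] by blast
      then have "(r, c) \<in> {1..nrows n} \<times> {1..ncols n}" using A(3) by blast
      then show ?thesis by (simp add: ends [OF rc]) (simp add: ladder_graph_def)
    qed
    show "card (ends ?G e) = 2" if e: "e \<in> edges ?G" for e
    proof -
      obtain r c where rc: "A (r, c) = Some e" using ex [OF e] by blast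
      show ?thesis by (simp add: ends [OF rc])
    qed
    show "\<exists>a b. \<forall>e \<in> edges ?G. e \<le> 2 * i + 4 \<longrightarrow>
      (a \<in> ends ?G e \<longleftrightarrow> e \<in> {2 * i + 3, 2 * i + 4}) \<and>
      (b \<in> ends ?G e \<longleftrightarrow> e \<in> {2 * i + 1, 2 * i + 2, 2 * i + 4})" if "i \<le> n" for i
      using A(6) [OF that] incident unfolding separated_def edges by simp
  qed (use minor A(4,5) in blast)+
qed

text \<open>The invariant of the construction, for an array in which row \<open>r\<close> was added last and column
  \<open>c\<close> just before it. The new row has its entries in the columns \<open>u\<close> and \<open>c\<close>; column \<open>c\<close> was
  created with entries in the rows \<open>v\<close> and \<open>r - 1\<close> and has received a third one in row \<open>r\<close>.
  That the positions \<open>(v, u)\<close> and \<open>(r - 1, u)\<close> are filled provides the two minors that contain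
  the new entries.\<close>

definition last_row_added :: "(nat \<times> nat \<rightharpoonup> nat) \<Rightarrow> nat \<Rightarrow> nat \<Rightarrow> nat \<Rightarrow> nat \<Rightarrow> nat \<Rightarrow> bool" where
  "last_row_added A n r c u v \<longleftrightarrow> dom A \<subseteq> {1..r} \<times> {1..c} \<and>
    u < c \<and> A (r, u) = Some (2 * n + 3) \<and> A (r, c) = Some (2 * n + 4) \<and> {c'. (r, c') \<in> dom A} = {u, c} \<and>
    v < r - 1 \<and> A (v, c) = Some (2 * n + 1) \<and> A (r - 1, c) = Some (2 * n + 2) \<and>
    {r'. (r', c) \<in> dom A} = {v, r - 1, r} \<and> (v, u) \<in> dom A \<and> (r - 1, u) \<in> dom A"

definition transposed :: "(nat \<times> nat \<rightharpoonup> nat) \<Rightarrow> (nat \<times> nat \<rightharpoonup> nat)" where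
  "transposed A = A \<circ> prod.swap"

lemma transposed_apply [simp]: "transposed A (r, c) = A (c, r)"
  by (simp add: transposed_def)

lemma mem_dom_transposed [simp]: "(r, c) \<in> dom (transposed A) \<longleftrightarrow> (c, r) \<in> dom A"
  by (auto simp: dom_def)

lemma transposed_transposed [simp]: "transposed (transposed A) = A"
  by (simp add: transposed_def comp_assoc)

lemma transposed_upd: "transposed (A((r, c) \<mapsto> j)) = (transposed A)((c, r) \<mapsto> j)"
  by (auto simp: fun_eq_iff)

text \<open>The new column \<open>c + 1\<close> has its entries in the rows \<open>w\<close> and \<open>r\<close>, and the old row \<open>r\<close> is
  the line before it, with entries in the columns \<open>u\<close> and \<open>c\<close>. The positions \<open>(w, u)\<close> and
  \<open>(w, c)\<close> are filled for both choices of \<open>w\<close>: the first by the condition on \<open>u\<close>, the second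
  because \<open>v\<close> and \<open>r - 1\<close> are rows in which column \<open>c\<close> has entries.\<close>

lemma last_row_added_step:
  assumes A: "last_row_added A n r c u v" and w: "w \<in> {v, r - 1}"
  shows "last_row_added (transposed (A((w, c + 1) \<mapsto> 2 * n + 5, (r, c + 1) \<mapsto> 2 * n + 6))) (n + 1) (c + 1) r w u"
proof -
  let ?B = "transposed (A((w, c + 1) \<mapsto> 2 * n + 5, (r, c + 1) \<mapsto> 2 * n + 6))"
  have dom: "dom A \<subseteq> {1..r} \<times> {1..c}" and u: "u < c" "A (r, u) = Some (2 * n + 3)"
    and rc: "A (r, c) = Some (2 * n + 4)" and row: "{c'. (r, c') \<in> dom A} = {u, c}"
    and v: "v < r - 1" "A (v, c) = Some (2 * n + 1)" "A (r - 1, c) = Some (2 * n + 2)"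
    and vu: "(v, u) \<in> dom A" "(r - 1, u) \<in> dom A"
    using A by (simp_all add: last_row_added_def)
  have w1: "1 \<le> w" "w < r" using w vu dom v by auto
  have none: "A (r', c + 1) = None" for r' using dom by force
  show ?thesis
    unfolding last_row_added_def
  proof (intro conjI)
    show "dom ?B \<subseteq> {1..c + 1} \<times> {1..r}"
    proof
      fix x assume "x \<in> dom ?B"
      moreover obtain a b where "x = (a, b)" by (cases x)
      ultimately obtain z where x: "x = (a, b)" "?B (a, b) = Some z" by blast
      have "1 \<le> b \<and> b \<le> r \<and> 1 \<le> a \<and> a \<le> c" if "A (b, a) = Some z"
        using subsetD [OF dom domI [of A, OF that]] by simp
      then show "x \<in> {1..c + 1} \<times> {1..r}"
        using x w1 by (auto split: if_splits)
    qed
    show "{c'. (c + 1, c') \<in> dom ?B} = {w, r}"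
      using none by (auto split: if_splits)
    have "{r'. (r', r) \<in> dom ?B} = {c'. (r, c') \<in> dom A} \<union> {c + 1}"
      using w1 by (auto split: if_splits)
    then show "{r'. (r', r) \<in> dom ?B} = {u, c + 1 - 1, c + 1}" using row by auto
    show "(u, w) \<in> dom ?B" using w vu by auto
    show "(c + 1 - 1, w) \<in> dom ?B" using w v by auto
  qed (use w1 u rc in auto)
qed

lemma last_row_added_on_minor:
  assumes "last_row_added A n r c u v"
  shows "on_minor A (2 * n + 2) (2 * n + 3) (2 * n + 4)" "on_minor A (2 * n + 1) (2 * n + 3) (2 * n + 4)"
proof -
  have A: "A (r, u) = Some (2 * n + 3)" "A (r, c) = Some (2 * n + 4)" "A (v, c) = Some (2 * n + 1)"
      "A (r - 1, c) = Some (2 * n + 2)" "(v, u) \<in> dom A" "(r - 1, u) \<in> dom A"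
    using assms by (simp_all add: last_row_added_def)
  from A(5,6) obtain f g where f: "A (v, u) = Some f" "A (r - 1, u) = Some g" by blast
  show "on_minor A (2 * n + 2) (2 * n + 3) (2 * n + 4)"
    unfolding on_minor_def
    by (intro exI [of _ "r - 1"] exI [of _ c] exI [of _ r] exI [of _ u] exI [of _ g]) (simp only: A f simp_thms)
  show "on_minor A (2 * n + 1) (2 * n + 3) (2 * n + 4)"
    unfolding on_minor_def
    by (intro exI [of _ v] exI [of _ c] exI [of _ r] exI [of _ u] exI [of _ f]) (simp only: A f simp_thms)
qed

lemma last_row_added_separated:
  assumes A: "last_row_added A n r c u v"
  shows "separated A n"
proof -
  have "incident A (Row r) = {j. \<exists>c' \<in> {c'. (r, c') \<in> dom A}. A (r, c') = Some j}"
    unfolding incident_def by auto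
  also have "\<dots> = {2 * n + 3, 2 * n + 4}"
    using A by (auto simp: last_row_added_def)
  finally have row: "incident A (Row r) = {2 * n + 3, 2 * n + 4}" .
  have "incident A (Col c) = {j. \<exists>r' \<in> {r'. (r', c) \<in> dom A}. A (r', c) = Some j}"
    unfolding incident_def by auto
  also have "\<dots> = {2 * n + 1, 2 * n + 2, 2 * n + 4}"
    using A by (auto simp: last_row_added_def)
  finally have "incident A (Col c) = {2 * n + 1, 2 * n + 2, 2 * n + 4}" .
  with row show ?thesis unfolding separated_def by blast
qed

lemma on_minor_transposed: "on_minor (transposed A) a b d \<longleftrightarrow> on_minor A a b d"
  unfolding on_minor_def transposed_apply by blast

lemma separated_transposed: "separated A n" if "separated (transposed A) n"
proof -
  define flip where "flip v = (case v of Row r \<Rightarrow> Col r | Col c \<Rightarrow> Row c)" for v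
  have "incident (transposed A) v = incident A (flip v)" for v
    by (cases v) (auto simp: incident_def flip_def)
  moreover have "ran (transposed A) = ran A"
    by (auto simp: ran_def)
  ultimately show ?thesis
    using that unfolding separated_def by auto
qed

lemma enumerate_three:
  fixes a b c :: nat
  assumes "a < b" "b < c"
  shows "enumerate {a, b, c} 0 = a" "enumerate {a, b, c} (Suc 0) = b"
proof -
  have a: "(LEAST x. x \<in> {a, b, c}) = a" using assms by (intro Least_equality) auto
  have b: "(LEAST x. x \<in> {b, c}) = b" using assms by (intro Least_equality) auto
  have "{a, b, c} - {a} = {b, c}" using assms by auto
  then show "enumerate {a, b, c} (Suc 0) = b" by (simp only: enumerate_0 enumerate_Suc a b)
  show "enumerate {a, b, c} 0 = a" by (simp only: enumerate_0 a)
qed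

text \<open>Minors persist because all entries stay in place. The condition \<open>separated A i\<close> concerns
  labels up to \<open>2i + 4\<close>, which are smaller than the new ones. So only the conditions for the largest
  values of \<open>i\<close> have to be checked.\<close>

lemma ladder_like_extend:
  assumes A: "ladder_like A n" and p: "p \<notin> dom A" "q \<notin> dom A" "p \<noteq> q"
    and B: "B = A(p \<mapsto> 2 * n + 5, q \<mapsto> 2 * n + 6)"
    and dom: "dom B \<subseteq> {1..nrows (n + 1)} \<times> {1..ncols (n + 1)}"
    and new: "on_minor B (2 * n + 4) (2 * n + 5) (2 * n + 6)" "on_minor B (2 * n + 3) (2 * n + 5) (2 * n + 6)"
      "separated B (n + 1)"
  shows "ladder_like B (n + 1)"
proof -
  have ran: "ran A = {0} \<union> {2..2 * n + 4}" and inj: "inj_on A (dom A)"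
    using A by (simp_all add: ladder_like_def)
  have ext: "B x = Some j" if "A x = Some j" for x j
    using that p by (auto simp: B)
  have old: "A x = Some j" if "B x = Some j" "j \<le> 2 * n + 4" for x j
    using that by (auto simp: B split: if_splits)
  have ran_B: "ran B = insert (2 * n + 6) (insert (2 * n + 5) (ran A))"
    unfolding B using p by (auto simp: ran_map_upd domIff)
  have minor: "on_minor B a b d" if m: "on_minor A a b d" for a b d
  proof -
    obtain s t s' t' f where "A (s, t) = Some a" "A (s', t') = Some b"
        "A (s, t') = Some d \<and> A (s', t) = Some f \<or> A (s, t') = Some f \<and> A (s', t) = Some d"
      using m unfolding on_minor_def by blast
    then have "B (s, t) = Some a" "B (s', t') = Some b"
        "B (s, t') = Some d \<and> B (s', t) = Some f \<or> B (s, t') = Some f \<and> B (s', t) = Some d"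
      using ext by auto
    then show ?thesis unfolding on_minor_def by blast
  qed
  have incident: "e \<in> incident B x \<longleftrightarrow> e \<in> incident A x" if "e \<le> 2 * n + 4" for e x
  proof -
    have "B y = Some e \<longleftrightarrow> A y = Some e" for y using ext old [OF _ that] by metis
    then show ?thesis by (cases x) simp_all
  qed
  have sep: "separated B i" if i: "i \<le> n" "separated A i" for i
  proof -
    obtain a b where ab: "\<forall>e \<in> ran A. e \<le> 2 * i + 4 \<longrightarrow>
        (e \<in> incident A a \<longleftrightarrow> e \<in> {2 * i + 3, 2 * i + 4}) \<and>
        (e \<in> incident A b \<longleftrightarrow> e \<in> {2 * i + 1, 2 * i + 2, 2 * i + 4})"
      using i(2) unfolding separated_def by blast
    have "(e \<in> incident B a \<longleftrightarrow> e \<in> {2 * i + 3, 2 * i + 4}) \<and>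
        (e \<in> incident B b \<longleftrightarrow> e \<in> {2 * i + 1, 2 * i + 2, 2 * i + 4})"
      if e: "e \<in> ran B" "e \<le> 2 * i + 4" for e
    proof -
      have "e \<in> ran A" "e \<le> 2 * n + 4" using e i(1) unfolding ran_B by auto
      then show ?thesis using ab e(2) incident by simp
    qed
    then show ?thesis unfolding separated_def by blast
  qed
  show ?thesis
    unfolding ladder_like_def
  proof (intro conjI dom ballI allI impI)
    show "ran B = {0} \<union> {2..2 * (n + 1) + 4}" unfolding ran_B ran by auto
    show "inj_on B (dom B)"
    proof (rule inj_onI)
      fix x y assume "x \<in> dom B" "y \<in> dom B" "B x = B y"
      then obtain j where j: "B x = Some j" "B y = Some j" by auto
      have "A z = Some i \<Longrightarrow> i \<le> 2 * n + 4" for z i using ran ranI [of A z i] by auto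
      then have A_ne: "A z \<noteq> Some (2 * n + 5)" "A z \<noteq> Some (2 * n + 6)" for z by fastforce+
      have "A x = A y \<and> x \<in> dom A \<and> y \<in> dom A \<or> x = y"
        using j A_ne [of x] A_ne [of y] unfolding B by (auto split: if_splits)
      then show "x = y" using inj by (auto dest: inj_onD)
    qed
    fix i
    show "on_minor B (2 * i) (2 * i + 1) (2 * i + 2)" if "i \<in> {1..n + 1 + 1}"
    proof (cases "i = n + 2")
      case True
      then have "2 * i = 2 * n + 4" "2 * i + 1 = 2 * n + 5" "2 * i + 2 = 2 * n + 6" by simp_all
      then show ?thesis using new(1) by (simp only:)
    next
      case False
      then show ?thesis using that A by (intro minor) (simp add: ladder_like_def)
    qed
    show "on_minor B (2 * i + 1) (2 * i + 3) (2 * i + 4)" if "i \<in> {1..n + 1}"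
    proof (cases "i = n + 1")
      case True
      then have "2 * i + 1 = 2 * n + 3" "2 * i + 3 = 2 * n + 5" "2 * i + 4 = 2 * n + 6" by simp_all
      then show ?thesis using new(2) by (simp only:)
    next
      case False
      then show ?thesis using that A by (intro minor) (simp add: ladder_like_def)
    qed
    show "separated B i" if "i \<le> n + 1"
    proof (cases "i = n + 1")
      case True
      then show ?thesis using new(3) by simp
    next
      case False
      then show ?thesis using that A by (intro sep) (simp_all add: ladder_like_def)
    qed
  qed
qed

lemma ladder_array_0_eq_Some_iff:
  "ladder_array 0 t (r, c) = Some j \<longleftrightarrow>
    r = 1 \<and> c = 1 \<and> j = 0 \<or> r = 1 \<and> c = 2 \<and> j = 2 \<or> r = 2 \<and> c = 1 \<and> j = 3 \<or> r = 2 \<and> c = 2 \<and> j = 4"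
  by simp blast

lemma ladder_like_0: "ladder_like (ladder_array 0 t) 0"
proof -
  let ?A = "ladder_array 0 t"
  note A = ladder_array_0_eq_Some_iff [of t]
  have ran: "ran ?A = {0, 2, 3, 4}"
  proof (rule Set.set_eqI)
    fix j
    have "j \<in> ran ?A \<longleftrightarrow> (\<exists>r c. ?A (r, c) = Some j)" by (simp add: ran_def)
    then show "j \<in> ran ?A \<longleftrightarrow> j \<in> {0, 2, 3, 4}" unfolding A by auto
  qed
  have edges: "{0} \<union> {2..2 * 0 + 4} = {0, 2, 3, 4 :: nat}" by auto
  have "on_minor ?A 2 3 4"
    unfolding on_minor_def A
    by (intro exI [of _ 1] exI [of _ 2] exI [of _ 2] exI [of _ 1] exI [of _ 0]) simp
  then have minor: "on_minor ?A (2 * i) (2 * i + 1) (2 * i + 2)" if "i \<in> {1..0 + 1}" for i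
    using that by (simp add: numeral_eq_Suc)
  have sep: "separated ?A 0"
    unfolding separated_def ran
    by (intro exI [of _ "Row 2"] exI [of _ "Col 2"]) (simp add: A del: ladder_array.simps)
  have inj: "inj_on ?A (dom ?A)"
  proof (rule inj_onI)
    fix x y assume "x \<in> dom ?A" "?A x = ?A y"
    then obtain j where "?A x = Some j" "?A y = Some j" by auto
    then show "x = y"
      by (cases x; cases y) (auto simp: A simp del: ladder_array.simps)
  qed
  have dom: "dom ?A \<subseteq> {1..nrows 0} \<times> {1..ncols 0}"
  proof
    fix x assume "x \<in> dom ?A"
    then obtain j where "?A x = Some j" by auto
    then show "x \<in> {1..nrows 0} \<times> {1..ncols 0}"
      by (cases x) (auto simp: A nrows_def ncols_def simp del: ladder_array.simps)
  qed
  show ?thesis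
    unfolding ladder_like_def ran edges using inj dom minor sep by simp
qed

lemma last_row_added_bounds:
  assumes "last_row_added A n r c u v" "w \<in> {v, r - 1}"
  shows "1 \<le> w" "w < r" "1 \<le> c"
proof -
  have "(v, u) \<in> dom A" "(r - 1, u) \<in> dom A" "dom A \<subseteq> {1..r} \<times> {1..c}" "v < r - 1" "u < c"
    using assms(1) by (simp_all add: last_row_added_def)
  then show "1 \<le> w" "w < r" "1 \<le> c" using assms(2) by auto
qed

lemma ladder_array_Suc_Suc:
  fixes k t
  defines "n \<equiv> Suc (Suc k)" and "A \<equiv> ladder_array (Suc k) (butlast t)" and "i \<equiv> if last t = 0 then 0 else 1"
  shows "even n \<Longrightarrow> ladder_array n t =
      A((nrows n, enumerate {c'. (nrows n - 1, c') \<in> dom A} i) \<mapsto> 2 * n + 3, (nrows n, ncols n) \<mapsto> 2 * n + 4)"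
    and "odd n \<Longrightarrow> ladder_array n t =
      A((enumerate {r'. (r', ncols n - 1) \<in> dom A} i, ncols n) \<mapsto> 2 * n + 3, (nrows n, ncols n) \<mapsto> 2 * n + 4)"
  unfolding n_def A_def i_def ladder_array.simps Let_def by simp_all

text \<open>Rows and columns are added alternately. Transposing for odd \<open>n\<close> turns the line added last
  into a row in both cases.\<close>

definition oriented :: "nat \<Rightarrow> (nat \<times> nat \<rightharpoonup> nat) \<Rightarrow> (nat \<times> nat \<rightharpoonup> nat)" where
  "oriented n A = (if even n then A else transposed A)"

definition last_line :: "nat \<Rightarrow> nat" where
  "last_line n = (if even n then nrows n else ncols n)"

definition previous_line :: "nat \<Rightarrow> nat" where
  "previous_line n = (if even n then ncols n else nrows n)"

lemma last_line_Suc: "last_line (Suc n) = previous_line n + 1"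
  by (auto simp: last_line_def previous_line_def nrows_def ncols_def elim!: evenE oddE)

lemma previous_line_Suc: "previous_line (Suc n) = last_line n"
  by (auto simp: last_line_def previous_line_def nrows_def ncols_def elim!: evenE oddE)

text \<open>In the oriented form both cases of the recursion read the same: a column is added, and the
  array is then transposed.\<close>

lemma oriented_ladder_array_Suc:
  fixes k t
  defines "A \<equiv> oriented (Suc k) (ladder_array (Suc k) (butlast t))" and "i \<equiv> if last t = 0 then 0 else 1"
    and "r \<equiv> last_line (Suc k)" and "c \<equiv> previous_line (Suc k)"
  shows "oriented (Suc (Suc k)) (ladder_array (Suc (Suc k)) t) =
    transposed (A((enumerate {r'. (r', c) \<in> dom A} i, c + 1) \<mapsto> 2 * Suc k + 5, (r, c + 1) \<mapsto> 2 * Suc k + 6))"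
proof -
  let ?n = "Suc (Suc k)"
  have last: "last_line ?n = c + 1" "previous_line ?n = r"
    unfolding r_def c_def by (rule last_line_Suc, rule previous_line_Suc)
  show ?thesis
  proof (cases "even ?n")
    case True
    then have eqs: "nrows ?n = c + 1" "ncols ?n = r"
      using last by (simp_all add: last_line_def previous_line_def)
    have "odd (Suc k)" using True by simp
    then have A: "A = transposed (ladder_array (Suc k) (butlast t))" by (simp add: A_def oriented_def)
    have "{c'. (nrows ?n - 1, c') \<in> dom (ladder_array (Suc k) (butlast t))} = {r'. (r', c) \<in> dom A}"
      unfolding A eqs by simp
    then have "ladder_array ?n t = (transposed A)((c + 1, enumerate {r'. (r', c) \<in> dom A} i) \<mapsto> 2 * ?n + 3, (c + 1, r) \<mapsto> 2 * ?n + 4)"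
      using ladder_array_Suc_Suc(1) [OF True, of t] unfolding eqs i_def A by simp
    moreover have "2 * ?n + 3 = 2 * Suc k + 5" "2 * ?n + 4 = 2 * Suc k + 6" by simp_all
    ultimately show ?thesis
      using True unfolding oriented_def transposed_upd by simp
  next
    case False
    then have eqs: "ncols ?n = c + 1" "nrows ?n = r"
      using last by (simp_all add: last_line_def previous_line_def)
    have "even (Suc k)" using False by simp
    then have A: "A = ladder_array (Suc k) (butlast t)" by (simp add: A_def oriented_def)
    have "{r'. (r', ncols ?n - 1) \<in> dom (ladder_array (Suc k) (butlast t))} = {r'. (r', c) \<in> dom A}"
      unfolding A eqs by simp
    then have "ladder_array ?n t = A((enumerate {r'. (r', c) \<in> dom A} i, c + 1) \<mapsto> 2 * ?n + 3, (r, c + 1) \<mapsto> 2 * ?n + 4)"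
      using ladder_array_Suc_Suc(2) [OF False, of t] unfolding eqs i_def A by simp
    moreover have "2 * ?n + 3 = 2 * Suc k + 5" "2 * ?n + 4 = 2 * Suc k + 6" by simp_all
    ultimately show ?thesis
      using False unfolding oriented_def by simp
  qed
qed

lemma on_minor_oriented: "on_minor (oriented n A) a b d \<longleftrightarrow> on_minor A a b d"
  by (simp add: oriented_def on_minor_transposed)

lemma separated_oriented: "separated (oriented n A) i \<Longrightarrow> separated A i"
  by (simp add: oriented_def separated_transposed split: if_splits)

lemma dom_oriented:
  "dom (oriented n A) \<subseteq> {1..last_line n} \<times> {1..previous_line n} \<Longrightarrow> dom A \<subseteq> {1..nrows n} \<times> {1..ncols n}"
proof (cases "even n")
  case False
  assume "dom (oriented n A) \<subseteq> {1..last_line n} \<times> {1..previous_line n}"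
  then have sub: "dom (transposed A) \<subseteq> {1..ncols n} \<times> {1..nrows n}"
    using False by (simp add: oriented_def last_line_def previous_line_def)
  have *: "(r, c) \<in> {1..nrows n} \<times> {1..ncols n}" if "(r, c) \<in> dom A" for r c
  proof -
    have "(c, r) \<in> dom (transposed A)" using that by (simp only: mem_dom_transposed)
    from subsetD [OF sub this] show ?thesis by simp
  qed
  show ?thesis
    by (rule subrelI) (rule *)
qed (simp add: oriented_def last_line_def previous_line_def)

lemma ladder_like_extend_last_row:
  assumes A: "ladder_like A n" and B: "B = A(p \<mapsto> 2 * n + 5, q \<mapsto> 2 * n + 6)"
    and p: "p \<notin> dom A" "q \<notin> dom A" "p \<noteq> q"
    and last: "last_row_added (oriented (n + 1) B) (n + 1) (last_line (n + 1)) (previous_line (n + 1)) u v"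
  shows "ladder_like B (n + 1)"
proof (rule ladder_like_extend [OF A p B])
  have "dom (oriented (n + 1) B) \<subseteq> {1..last_line (n + 1)} \<times> {1..previous_line (n + 1)}"
    using last by (simp only: last_row_added_def)
  then show "dom B \<subseteq> {1..nrows (n + 1)} \<times> {1..ncols (n + 1)}" by (rule dom_oriented)
  show "on_minor B (2 * n + 4) (2 * n + 5) (2 * n + 6)" "on_minor B (2 * n + 3) (2 * n + 5) (2 * n + 6)"
  proof -
    have "2 * (n + 1) + 1 = 2 * n + 3" "2 * (n + 1) + 2 = 2 * n + 4" "2 * (n + 1) + 3 = 2 * n + 5" "2 * (n + 1) + 4 = 2 * n + 6"
      by simp_all
    then show "on_minor B (2 * n + 4) (2 * n + 5) (2 * n + 6)" "on_minor B (2 * n + 3) (2 * n + 5) (2 * n + 6)"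
      using last_row_added_on_minor [OF last] by (simp_all only: on_minor_oriented)
  qed
  show "separated B (n + 1)"
    by (rule separated_oriented [OF last_row_added_separated [OF last]])
qed

lemma ladder_array_1:
  "ladder_like (ladder_array 1 t) 1"
  "last_row_added (oriented 1 (ladder_array 1 t)) 1 (last_line 1) (previous_line 1) 1 1"
proof -
  let ?A = "ladder_array 1 t"
  have A: "?A = (ladder_array 0 t)((1, 3) \<mapsto> 5, (2, 3) \<mapsto> 6)"
    by (simp add: fun_eq_iff)
  have lines: "last_line 1 = 3" "previous_line 1 = 2" "oriented 1 ?A = transposed ?A"
    by (simp_all add: last_line_def previous_line_def nrows_def ncols_def oriented_def)
  have "dom (transposed ?A) = {(1, 1), (2, 1), (3, 1), (1, 2), (2, 2), (3, 2)}"
    unfolding A by (auto split: if_splits)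
  then show last: "last_row_added (oriented 1 ?A) 1 (last_line 1) (previous_line 1) 1 1"
    unfolding lines last_row_added_def by (simp only: transposed_apply) (auto simp: A)
  have "ladder_like ?A (0 + 1)"
  proof (rule ladder_like_extend_last_row [OF ladder_like_0])
    show "?A = (ladder_array 0 t)((1, 3) \<mapsto> 2 * 0 + 5, (2, 3) \<mapsto> 2 * 0 + 6)" using A by simp
    show "last_row_added (oriented (0 + 1) ?A) (0 + 1) (last_line (0 + 1)) (previous_line (0 + 1)) 1 1"
      using last by simp
  qed auto
  then show "ladder_like ?A 1" by simp
qed

lemma ladder_array_Suc:
  "ladder_like (ladder_array (Suc k) t) (Suc k) \<and>
    (\<exists>u v. last_row_added (oriented (Suc k) (ladder_array (Suc k) t)) (Suc k) (last_line (Suc k)) (previous_line (Suc k)) u v)"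
proof (induction k arbitrary: t)
  case 0
  show ?case using ladder_array_1 [of t] by (simp only: One_nat_def) blast
next
  case (Suc k)
  define L where "L = ladder_array (Suc k) (butlast t)"
  define A where "A = oriented (Suc k) L"
  define r where "r = last_line (Suc k)"
  define c where "c = previous_line (Suc k)"
  define i where "i = (if last t = 0 then 0 else 1 :: nat)"
  define B where "B = ladder_array (Suc (Suc k)) t"
  from Suc obtain u v where A: "last_row_added A (Suc k) r c u v" and L: "ladder_like L (Suc k)"
    unfolding A_def L_def r_def c_def by blast
  define w where "w = enumerate {r'. (r', c) \<in> dom A} i"
  have column: "{r'. (r', c) \<in> dom A} = {v, r - 1, r}" "v < r - 1" and dom: "dom A \<subseteq> {1..r} \<times> {1..c}"
    using A by (simp_all add: last_row_added_def)
  have w: "w \<in> {v, r - 1}"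
    using enumerate_three [of v "r - 1" r] column(2) unfolding w_def column(1) i_def by auto
  note bounds = last_row_added_bounds [OF A w]
  have B: "oriented (Suc (Suc k)) B = transposed (A((w, c + 1) \<mapsto> 2 * Suc k + 5, (r, c + 1) \<mapsto> 2 * Suc k + 6))"
    unfolding B_def A_def L_def w_def r_def c_def i_def by (rule oriented_ladder_array_Suc)
  have last: "last_row_added (oriented (Suc k + 1) B) (Suc k + 1) (last_line (Suc k + 1)) (previous_line (Suc k + 1)) w u"
    using last_row_added_step [OF A w] B unfolding r_def c_def
    by (simp add: last_line_Suc previous_line_Suc)
  have fresh: "(x, c + 1) \<notin> dom A" for x
    using dom by auto
  have "\<exists>p q. B = L(p \<mapsto> 2 * Suc k + 5, q \<mapsto> 2 * Suc k + 6) \<and> p \<notin> dom L \<and> q \<notin> dom L \<and> p \<noteq> q"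
  proof (cases "even (Suc k)")
    case True
    have LA: "A = L" using True by (simp add: A_def oriented_def)
    have "transposed B = transposed (A((w, c + 1) \<mapsto> 2 * Suc k + 5, (r, c + 1) \<mapsto> 2 * Suc k + 6))"
      using B True by (simp add: oriented_def)
    then have "B = A((w, c + 1) \<mapsto> 2 * Suc k + 5, (r, c + 1) \<mapsto> 2 * Suc k + 6)"
      using transposed_transposed by metis
    then show ?thesis
      using fresh bounds unfolding LA by (intro exI [of _ "(w, c + 1)"] exI [of _ "(r, c + 1)"]) simp
  next
    case False
    have LA: "L = transposed A" using False by (simp add: A_def oriented_def)
    have "B = L((c + 1, w) \<mapsto> 2 * Suc k + 5, (c + 1, r) \<mapsto> 2 * Suc k + 6)"
      using B False unfolding LA transposed_upd by (simp add: oriented_def)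
    moreover have "(c + 1, x) \<notin> dom L" for x unfolding LA mem_dom_transposed by (rule fresh)
    ultimately show ?thesis
      using bounds by (intro exI [of _ "(c + 1, w)"] exI [of _ "(c + 1, r)"]) simp
  qed
  then obtain p q where "B = L(p \<mapsto> 2 * Suc k + 5, q \<mapsto> 2 * Suc k + 6)" "p \<notin> dom L" "q \<notin> dom L" "p \<noteq> q"
    by blast
  from ladder_like_extend_last_row [OF L this last] last show ?case
    unfolding B_def by (simp only: Suc_eq_plus1) blast
qed

lemma ladder_toric_ladder_graph: "ladder_toric n (ladder_graph n t)"
proof (rule ladder_like_imp_ladder_toric)
  show "ladder_like (ladder_array n t) n"
  proof (cases n)
    case 0
    then show ?thesis using ladder_like_0 by simp
  next
    case (Suc k)
    then show ?thesis using ladder_array_Suc by simp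
  qed
qed

section \<open>The length formula\<close>

lemma ring_length_toric_Rhat: "ring_length (toric_Rhat TYPE('k::field) n t) = enat (fib (n + 3))"
proof -
  interpret ladder_toric n "ladder_graph n t" by (rule ladder_toric_ladder_graph)
  have P: "poly_S TYPE('k) n = (P :: (nat, 'k) mpoly ring)" by (simp only: poly_S_def edges_eq)
  show ?thesis
    unfolding toric_Rhat_def toric_R_def params_Xbar_def P by (rule ring_length_eq_fib)
qed

lemma fib_closed_form_pow:
  "real (fib m) = ((1 + sqrt 5) ^ m - (1 - sqrt 5) ^ m) / (2 ^ m * sqrt 5)"
proof -
  have "real (fib m) = ((1 + sqrt 5) ^ m / 2 ^ m - (1 - sqrt 5) ^ m / 2 ^ m) / sqrt 5"
    unfolding fib_closed_form power_divide ..
  also have "\<dots> = ((1 + sqrt 5) ^ m - (1 - sqrt 5) ^ m) / (2 ^ m * sqrt 5)"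
    by (simp only: diff_divide_distrib [symmetric] divide_divide_eq_left)
  finally show ?thesis .
qed

theorem proposition3p19:
  shows "(\<forall>(n::nat) (t::bit list) (t'::bit list) (t''::bit list).
            n \<ge> 2 \<longrightarrow> length t = n + 1 \<longrightarrow> length t' = n \<longrightarrow> length t'' = n - 1 \<longrightarrow>
            ring_length (toric_Rhat TYPE('k::field) n t) =
              ring_length (toric_Rhat TYPE('k) (n - 1) t') + ring_length (toric_Rhat TYPE('k) (n - 2) t''))
       \<and> (\<forall>(n::nat) (t::bit list). length t = n + 1 \<longrightarrow>
            ring_length (toric_Rhat TYPE('k) n t) = enat (fib (n + 3)) \<and>
            real (fib (n + 3)) =
              ((1 + sqrt 5) ^ (n + 3) - (1 - sqrt 5) ^ (n + 3)) / (2 ^ (n + 3) * sqrt 5))"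
proof (intro conjI allI impI)
  fix n :: nat and t t' t'' :: "bit list"
  assume "n \<ge> 2"
  then obtain m where "n = m + 2" by (metis add.commute le_Suc_ex)
  then have "fib (n + 3) = fib (n - 1 + 3) + fib (n - 2 + 3)" by (simp add: numeral_3_eq_3)
  then show "ring_length (toric_Rhat TYPE('k) n t) =
      ring_length (toric_Rhat TYPE('k) (n - 1) t') + ring_length (toric_Rhat TYPE('k) (n - 2) t'')"
    unfolding ring_length_toric_Rhat plus_enat_simps by simp
qed (rule ring_length_toric_Rhat, rule fib_closed_form_pow)

end
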